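(* Consider a MIMO multiple-access system (or a point-to-point MIMO system with V-BLAST transmission) with $M$ transmit and $N$ receive antennas, $M\le N$, described by $\mathbf{y}=\mathbf{H}\mathbf{x}+\mathbf{w}$, where the entries of the $N\times M$ channel matrix $\mathbf{H}$ are i.i.d. zero-mean unit-variance circularly symmetric complex Gaussian, the transmitted vector $\mathbf{x}$ has independent entries from a finite constellation contained in $\mathbb{Z}[i]$, and the noise $\mathbf{w}$ is independent of $\mathbf{H}$ and $\mathbf{x}$ with i.i.d. zero-mean circularly symmetric complex Gaussian entries of variance $\sigma^2$; the SNR is $\rho=1/\sigma^2$. When the receiver uses naive lattice decoding, the error probability $P_e$ satisfies $$\lim_{\rho\to\infty}\frac{-\log P_e}{\log\rho}=N.$$
   Context: $\mathbb{Z}[i]$ is the ring of Gaussian integers. Naive lattice decoding outputs $\widehat{\mathbf{x}}=\arg\min_{\mathbf{z}\in\mathbb{Z}[i]^M}\|\mathbf{y}-\mathbf{H}\mathbf{z}\|$ (the closest point of the whole lattice generated by $\mathbf{H}$, ignoring the constellation boundary); a decoded point outside the constellation is counted as an error, and $P_e=\Pr\{\widehat{\mathbf{x}}\neq\mathbf{x}\}$. *)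

theory Defs
  imports "HOL-Probability.Probability"
begin

definition gauss_int :: "complex \<Rightarrow> bool" where
  "gauss_int z \<longleftrightarrow> Re z \<in> \<int> \<and> Im z \<in> \<int>"

definition cgauss :: "real \<Rightarrow> complex measure" where
  "cgauss s2 = density lborel (\<lambda>z. ennreal (exp (- (cmod z)\<^sup>2 / s2) / (pi * s2)))"

definition sqdist_rx :: "nat \<Rightarrow> nat \<Rightarrow> (nat \<Rightarrow> complex) \<Rightarrow> (nat \<times> nat \<Rightarrow> complex)
    \<Rightarrow> (nat \<Rightarrow> complex) \<Rightarrow> real" where
  "sqdist_rx N M y H z = (\<Sum>i<N. (cmod (y i - (\<Sum>j<M. H (i, j) * z j)))\<^sup>2)"

definition chan_out :: "nat \<Rightarrow> nat \<Rightarrow> (nat \<times> nat \<Rightarrow> complex) \<Rightarrow> (nat \<Rightarrow> complex)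
    \<Rightarrow> (nat \<Rightarrow> complex) \<Rightarrow> (nat \<Rightarrow> complex)" where
  "chan_out N M H x w = (\<lambda>i. (\<Sum>j<M. H (i, j) * x j) + w i)"

text \<open>Naive lattice decoding error: the transmitted x is not the unique closest
  point of the whole lattice H Z[i]^M to y (ties are counted as errors; they
  occur with probability zero).\<close>
definition nld_error :: "nat \<Rightarrow> nat \<Rightarrow> (nat \<times> nat \<Rightarrow> complex) \<Rightarrow> (nat \<Rightarrow> complex)
    \<Rightarrow> (nat \<Rightarrow> complex) \<Rightarrow> bool" where
  "nld_error N M H x w \<longleftrightarrow>
     (\<exists>z. (\<forall>j<M. gauss_int (z j)) \<and> (\<exists>j<M. z j \<noteq> x j) \<and>
          sqdist_rx N M (chan_out N M H x w) H z \<le> sqdist_rx N M (chan_out N M H x w) H x)"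

definition mimo_space :: "nat \<Rightarrow> nat \<Rightarrow> (nat \<Rightarrow> complex pmf) \<Rightarrow> real
    \<Rightarrow> ((nat \<times> nat \<Rightarrow> complex) \<times> (nat \<Rightarrow> complex) \<times> (nat \<Rightarrow> complex)) measure" where
  "mimo_space M N p sigma2 =
     (\<Pi>\<^sub>M ij\<in>{..<N} \<times> {..<M}. cgauss 1) \<Otimes>\<^sub>M
     (\<Pi>\<^sub>M j\<in>{..<M}. measure_pmf (p j)) \<Otimes>\<^sub>M
     (\<Pi>\<^sub>M i\<in>{..<N}. cgauss sigma2)"

definition err_prob :: "nat \<Rightarrow> nat \<Rightarrow> (nat \<Rightarrow> complex pmf) \<Rightarrow> real \<Rightarrow> real" where
  "err_prob M N p rho =
     measure (mimo_space M N p (1 / rho))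
       {\<omega> \<in> space (mimo_space M N p (1 / rho)).
          nld_error N M (fst \<omega>) (fst (snd \<omega>)) (snd (snd \<omega>))}"

end

theory Submission
  imports Defs "HOL-Real_Asymp.Real_Asymp"
begin

text \<open>
  Translating by \<open>x\<close>, an error occurs iff some nonzero \<open>d \<in> \<int>[i]\<^sup>M\<close> satisfies
  \<open>\<parallel>w - H d\<parallel> \<le> \<parallel>w\<parallel>\<close>. Already \<open>d = e\<^sub>1\<close> gives \<open>P\<^sub>e \<ge> c \<rho>\<^sup>-\<^sup>N\<close>, because each of the \<open>N\<close> entries of the first
  column falls into a disc of area of order \<open>1/\<rho>\<close> with probability of that order.

  For the converse, condition on \<open>w\<close> and put \<open>r = 2 \<Sum>\<^sub>i |w\<^sub>i|\<close>, so that an error forces all entries of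
  \<open>H d\<close> to be at most \<open>r\<close>. Conditioning on all columns but one with \<open>|d\<^sub>j|\<close> maximal bounds the
  probability of this by \<open>(r / |d|\<^sub>\<infinity>)\<^sup>2\<^sup>N \<le> r\<^sup>2\<^sup>N \<Prod>\<^sub>j max(1, |d\<^sub>j|)\<^sup>-\<^sup>2\<close>, and summing over a box of
  side \<open>L\<close> costs only a power of \<open>ln L\<close>. For \<open>M = N\<close> the sum over the whole lattice diverges, so the
  vectors outside the box are treated together: a vector orthogonal to all columns but the \<open>j\<close>-th
  shows that some such \<open>d\<close> with \<open>|d\<^sub>j| \<ge> L\<close> exists with probability at most \<open>(N r / L)\<^sup>2\<close>. With \<open>L\<close> about \<open>\<rho>\<^sup>N\<close> this gives
  \<open>P\<^sub>e \<le> C (1 + ln \<rho>)\<^sup>2\<^sup>M \<rho>\<^sup>-\<^sup>N\<close>.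
\<close>

subsection \<open>Circularly symmetric Gaussians\<close>

lemma sets_cgauss [simp, measurable_cong]: "sets (cgauss s) = sets borel"
  by (simp add: cgauss_def)

lemma space_cgauss [simp]: "space (cgauss s) = UNIV"
  by (simp add: cgauss_def)

text \<open>Since \<open>(cmod z)^2\<close> is the sum of the squares of \<open>Re z\<close> and
  \<open>Im z\<close>, the density factors into two real normal densities of variance
  \<open>s / 2\<close>, one per element of \<open>Basis\<close>, each of total mass 1.\<close>

lemma nn_integral_cgauss_density:
  assumes "0 < s"
  shows "(\<integral>\<^sup>+z. ennreal (exp (- (cmod z)\<^sup>2 / s) / (pi * s)) \<partial>lborel) = 1"
proof -
  define f :: "real \<Rightarrow> ennreal" where "f = (\<lambda>x. ennreal (normal_density 0 (sqrt (s / 2)) x))"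
  have [measurable]: "f \<in> borel_measurable borel"
    by (simp add: f_def)
  have f1: "(\<integral>\<^sup>+x. f x \<partial>lborel) = 1"
  proof -
    interpret prob_space "density lborel f"
      unfolding f_def using assms by (intro prob_space_normal_density) simp
    show ?thesis using emeasure_space_1 by (simp add: emeasure_density)
  qed
  have "ennreal (exp (- (cmod z)\<^sup>2 / s) / (pi * s)) = (\<Prod>b\<in>Basis. f (z \<bullet> b))" for z
  proof -
    have "exp (- (cmod z)\<^sup>2 / s) / (pi * s)
      = normal_density 0 (sqrt (s / 2)) (Re z) * normal_density 0 (sqrt (s / 2)) (Im z)"
      using assms by (simp add: normal_density_def cmod_power2 exp_add [symmetric] field_simps
          add_divide_distrib [symmetric])
    then show ?thesis
      by (simp add: Basis_complex_def f_def ennreal_mult' prod.insert inner_complex_def)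
  qed
  then have "(\<integral>\<^sup>+z. ennreal (exp (- (cmod z)\<^sup>2 / s) / (pi * s)) \<partial>lborel)
    = (\<integral>\<^sup>+z. (\<Prod>b\<in>Basis. f (z \<bullet> b)) \<partial>(lborel :: complex measure))"
    by simp
  also have "\<dots> = (\<Prod>b\<in>(Basis :: complex set). \<integral>\<^sup>+x. f x \<partial>lborel)"
    by (rule nn_integral_lborel_prod) auto
  also have "\<dots> = 1" by (simp add: f1)
  finally show ?thesis .
qed

lemma prob_space_cgauss:
  assumes "0 < s"
  shows "prob_space (cgauss s)"
  using nn_integral_cgauss_density[OF assms]
  by (intro prob_spaceI) (simp add: cgauss_def emeasure_density)

lemma emeasure_lborel_cball_complex:
  fixes c :: complex
  assumes "0 \<le> r"
  shows "emeasure lborel (cball c r) = ennreal (pi * r\<^sup>2)"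
  using assms by (simp add: emeasure_cball unit_ball_vol_2)

text \<open>The density never exceeds \<open>1 / (pi * s)\<close> and the disc has area
  \<open>pi * r^2\<close>. The centre does not enter the bound, which therefore survives
  conditioning on whatever determines \<open>c\<close>.\<close>

lemma emeasure_cgauss_cball_le:
  assumes "0 < s" "0 \<le> r"
  shows "emeasure (cgauss s) (cball c r) \<le> ennreal (r\<^sup>2 / s)"
proof -
  have "emeasure (cgauss s) (cball c r)
    = (\<integral>\<^sup>+z. ennreal (exp (- (cmod z)\<^sup>2 / s) / (pi * s)) * indicator (cball c r) z \<partial>lborel)"
    by (simp add: cgauss_def emeasure_density)
  also have "\<dots> \<le> (\<integral>\<^sup>+z. ennreal (1 / (pi * s)) * indicator (cball c r) z \<partial>lborel)"
    using assms by (intro nn_integral_mono mult_right_mono ennreal_leI divide_right_mono) auto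
  also have "\<dots> = ennreal (1 / (pi * s)) * ennreal (pi * r\<^sup>2)"
    using assms by (simp add: nn_integral_cmult_indicator emeasure_lborel_cball_complex)
  also have "\<dots> = ennreal (r\<^sup>2 / s)"
    using assms by (simp add: ennreal_mult [symmetric])
  finally show ?thesis .
qed

text \<open>On the disc the density is at least its value at modulus \<open>cmod c + r\<close>, the
  largest modulus found there.\<close>

lemma emeasure_cgauss_cball_ge:
  assumes "0 < s" "0 \<le> r"
  shows "ennreal (r\<^sup>2 * exp (- (cmod c + r)\<^sup>2 / s) / s) \<le> emeasure (cgauss s) (cball c r)"
proof -
  let ?e = "exp (- (cmod c + r)\<^sup>2 / s)"
  have "ennreal (r\<^sup>2 * ?e / s) = ennreal (?e / (pi * s)) * ennreal (pi * r\<^sup>2)"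
    using assms by (simp add: ennreal_mult [symmetric] mult.commute)
  also have "\<dots> = (\<integral>\<^sup>+z. ennreal (?e / (pi * s)) * indicator (cball c r) z \<partial>lborel)"
    using assms by (simp add: nn_integral_cmult_indicator emeasure_lborel_cball_complex)
  also have "\<dots> \<le> (\<integral>\<^sup>+z. ennreal (exp (- (cmod z)\<^sup>2 / s) / (pi * s)) * indicator (cball c r) z \<partial>lborel)"
  proof (intro nn_integral_mono)
    fix z
    have "?e \<le> exp (- (cmod z)\<^sup>2 / s)" if "z \<in> cball c r"
    proof -
      have "cmod z \<le> cmod c + r"
        using that norm_triangle_ineq2[of z c] by (simp add: dist_norm norm_minus_commute)
      then have "(cmod z)\<^sup>2 \<le> (cmod c + r)\<^sup>2" by (intro power_mono) auto
      then show ?thesis using assms by (simp add: divide_right_mono)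
    qed
    then show "ennreal (?e / (pi * s)) * indicator (cball c r) z
      \<le> ennreal (exp (- (cmod z)\<^sup>2 / s) / (pi * s)) * indicator (cball c r) z"
      using assms by (auto simp: indicator_def intro!: ennreal_leI divide_right_mono)
  qed
  also have "\<dots> = emeasure (cgauss s) (cball c r)"
    by (simp add: cgauss_def emeasure_density)
  finally show ?thesis .
qed

text \<open>Half of the Gaussian exponent absorbs the power of \<open>cmod z\<close>; the other half
  is, up to the leading factor 2, the density with parameter \<open>2 * s\<close>, of total mass 1.
  Only the order \<open>s ^ n\<close> matters later, not the constant.\<close>

lemma cgauss_moment_le:
  assumes "0 < s"
  shows "(\<integral>\<^sup>+z. ennreal (cmod z ^ (2 * n)) \<partial>cgauss s) \<le> ennreal (2 * fact n * (2 * s) ^ n)"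
proof -
  have pw: "exp (- (cmod z)\<^sup>2 / s) / (pi * s) * cmod z ^ (2 * n)
    \<le> 2 * fact n * (2 * s) ^ n * (exp (- (cmod z)\<^sup>2 / (2 * s)) / (pi * (2 * s)))" for z
  proof -
    define t where "t = (cmod z)\<^sup>2 / (2 * s)"
    have t0: "0 \<le> t" using assms by (simp add: t_def)
    \<comment> \<open>A single term of the exponential series is at most the whole series, all terms
      being nonnegative.\<close>
    have "t ^ n / fact n \<le> exp t"
    proof -
      have "(\<Sum>k\<in>{n}. t ^ k /\<^sub>R fact k) \<le> (\<Sum>k. t ^ k /\<^sub>R fact k)"
        using t0 by (intro sum_le_suminf summable_exp_generic) auto
      then show ?thesis by (simp add: exp_def field_simps)
    qed
    then have "t ^ n \<le> fact n * exp t" by (simp add: field_simps)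
    moreover have "cmod z ^ (2 * n) = (2 * s) ^ n * t ^ n"
      unfolding power_mult_distrib [symmetric] using assms by (simp add: t_def power_mult)
    ultimately have "cmod z ^ (2 * n) \<le> (2 * s) ^ n * (fact n * exp t)"
      using assms by simp
    then have "exp (- (cmod z)\<^sup>2 / s) * cmod z ^ (2 * n)
      \<le> exp (- (cmod z)\<^sup>2 / s) * ((2 * s) ^ n * (fact n * exp t))"
      by (intro mult_left_mono) auto
    also have "\<dots> = (2 * s) ^ n * fact n * exp (- (cmod z)\<^sup>2 / (2 * s))"
    proof -
      have "- (cmod z)\<^sup>2 / s + t = - (cmod z)\<^sup>2 / (2 * s)"
        using assms by (simp add: t_def field_simps)
      then show ?thesis by (simp add: exp_add [symmetric] mult_ac)
    qed
    finally have "exp (- (cmod z)\<^sup>2 / s) * cmod z ^ (2 * n) / (pi * s)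
      \<le> (2 * s) ^ n * fact n * exp (- (cmod z)\<^sup>2 / (2 * s)) / (pi * s)"
      using assms by (intro divide_right_mono) auto
    then show ?thesis using assms by (simp add: field_simps)
  qed
  have "(\<integral>\<^sup>+z. ennreal (cmod z ^ (2 * n)) \<partial>cgauss s)
    = (\<integral>\<^sup>+z. ennreal (exp (- (cmod z)\<^sup>2 / s) / (pi * s) * cmod z ^ (2 * n)) \<partial>lborel)"
    using assms by (simp add: cgauss_def nn_integral_density ennreal_mult [symmetric])
  also have "\<dots> \<le> (\<integral>\<^sup>+z. ennreal (2 * fact n * (2 * s) ^ n) *
      ennreal (exp (- (cmod z)\<^sup>2 / (2 * s)) / (pi * (2 * s))) \<partial>lborel)"
    using assms by (subst ennreal_mult [symmetric], simp, simp)
      (intro nn_integral_mono ennreal_leI pw)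
  also have "\<dots> = ennreal (2 * fact n * (2 * s) ^ n)"
    using assms nn_integral_cgauss_density[of "2 * s"] by (subst nn_integral_cmult) auto
  finally show ?thesis .
qed

subsection \<open>Small-ball estimates\<close>

text \<open>Gaussian elimination by induction on the equations: a nonzero coefficient in equation
  \<open>j\<close> removes one equation and one unknown. It later supplies a vector of length
  \<open>N\<close> orthogonal to \<open>M - 1\<close> columns.\<close>

lemma underdetermined_system_nontrivial_solution:
  fixes a :: "'i \<Rightarrow> 'j \<Rightarrow> 'a :: field"
  assumes "finite J" "finite I" "card J < card I"
  shows "\<exists>u. (\<exists>i\<in>I. u i \<noteq> 0) \<and> (\<forall>j\<in>J. (\<Sum>i\<in>I. u i * a i j) = 0)"
  using assms
proof (induction J arbitrary: I a rule: finite_induct)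
  case empty
  then have "I \<noteq> {}" by auto
  then show ?case by (intro exI[of _ "\<lambda>_. 1"]) auto
next
  case (insert j J)
  show ?case
  proof (cases "\<forall>i\<in>I. a i j = 0")
    case True
    have "card J < card I" using insert by simp
    with insert.IH[of I a] insert.prems True show ?thesis by (auto intro!: exI)
  next
    case False
    then obtain k where k: "k \<in> I" "a k j \<noteq> 0" by auto
    have "card J < card (I - {k})" using insert k by simp
    \<comment> \<open>These coefficients remain in the equations \<open>J\<close> once equation
      \<open>j\<close> has been solved for unknown \<open>k\<close> and substituted;
      \<open>v\<close> below restores the eliminated unknown.\<close>
    with insert.IH[of "I - {k}" "\<lambda>i l. a i l - a i j / a k j * a k l"] insert.prems
    obtain u where u: "\<exists>i\<in>I - {k}. u i \<noteq> 0"
      "\<And>l. l \<in> J \<Longrightarrow> (\<Sum>i\<in>I - {k}. u i * (a i l - a i j / a k j * a k l)) = 0"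
      by auto
    define v where "v = u(k := - (\<Sum>i\<in>I - {k}. u i * a i j) / a k j)"
    have split: "(\<Sum>i\<in>I. v i * a i l) = v k * a k l + (\<Sum>i\<in>I - {k}. u i * a i l)" for l
    proof -
      have "(\<Sum>i\<in>I - {k}. v i * a i l) = (\<Sum>i\<in>I - {k}. u i * a i l)"
        by (intro sum.cong) (auto simp: v_def)
      then show ?thesis using k insert.prems by (simp add: sum.remove)
    qed
    have "(\<Sum>i\<in>I. v i * a i j) = 0"
      using k by (simp add: split) (simp add: v_def)
    moreover have "(\<Sum>i\<in>I. v i * a i l) = 0" if "l \<in> J" for l
    proof -
      have "(\<Sum>i\<in>I - {k}. u i * (a i l - a i j / a k j * a k l))
        = (\<Sum>i\<in>I - {k}. u i * a i l) - (\<Sum>i\<in>I - {k}. u i * a i j) / a k j * a k l"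
        by (simp add: right_diff_distrib sum_subtractf sum_distrib_left sum_divide_distrib mult_ac)
      then show ?thesis using u(2)[OF that] by (simp add: split) (simp add: v_def)
    qed
    moreover have "\<exists>i\<in>I. v i \<noteq> 0" using u(1) by (auto simp: v_def)
    ultimately show ?thesis by blast
  qed
qed

section \<open>Conditioning on coordinates of a Gaussian product measure\<close>

lemma product_prob_space_cgauss:
  assumes "0 < s"
  shows "product_prob_space (\<lambda>_ :: 'i. cgauss s)"
  by (intro product_prob_spaceI prob_space_cgauss assms)

text \<open>Fubini: the conditioned coordinates \<open>K\<close> carry total mass 1, so a slice
  bound uniform in \<open>x\<close> bounds the whole measure.\<close>

lemma (in product_prob_space) emeasure_PiM_le_slices:
  assumes KJ: "K \<inter> J = {}" "finite K" "finite J"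
    and A: "A \<in> sets (PiM (K \<union> J) M)"
    and slice: "\<And>x. x \<in> space (PiM K M) \<Longrightarrow>
      emeasure (PiM J M) {y \<in> space (PiM J M). merge K J (x, y) \<in> A} \<le> B"
  shows "emeasure (PiM (K \<union> J) M) A \<le> B"
proof -
  interpret K: prob_space "PiM K M"
    by (intro prob_space_PiM prob_space)
  have "emeasure (PiM (K \<union> J) M) A
    = (\<integral>\<^sup>+x. emeasure (PiM J M) ((\<lambda>y. merge K J (x, y)) -` A \<inter> space (PiM J M)) \<partial>PiM K M)"
    by (rule emeasure_fold_integral[OF KJ A])
  also have "\<dots> \<le> (\<integral>\<^sup>+x. B \<partial>PiM K M)"
  proof (intro nn_integral_mono)
    fix x assume "x \<in> space (PiM K M)"
    moreover have "(\<lambda>y. merge K J (x, y)) -` A \<inter> space (PiM J M)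
      = {y \<in> space (PiM J M). merge K J (x, y) \<in> A}" by auto
    ultimately show "emeasure (PiM J M) ((\<lambda>y. merge K J (x, y)) -` A \<inter> space (PiM J M)) \<le> B"
      using slice by simp
  qed
  also have "\<dots> = B" by (simp add: K.emeasure_space_1)
  finally show ?thesis .
qed

lemma ex_maximizer_finite:
  fixes f :: "'a \<Rightarrow> 'b :: linorder"
  assumes "finite S" "S \<noteq> {}"
  shows "\<exists>k\<in>S. \<forall>i\<in>S. f i \<le> f k"
proof -
  have "Max (f ` S) \<in> f ` S" using assms by (intro Max_in) auto
  then obtain k where "k \<in> S" "f k = Max (f ` S)" by auto
  then show ?thesis using assms by (intro bexI[of _ k]) auto
qed

lemma affine_le_imp_cball:
  fixes a b z :: complex
  assumes "a \<noteq> 0" "cmod (a * z + b) \<le> r"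
  shows "z \<in> cball (- b / a) (r / cmod a)"
proof -
  have "- b / a - z = - (a * z + b) / a" using assms(1) by (simp add: field_simps)
  then have "dist (- b / a) z = cmod (a * z + b) / cmod a"
    by (simp add: dist_norm norm_divide norm_minus_cancel del: minus_add_distrib)
  with assms show ?thesis by (simp add: divide_right_mono)
qed

text \<open>Given all coordinates except \<open>k\<close>, the event puts \<open>y k\<close> into a
  disc of radius \<open>t / cmod (a k)\<close>; only its centre depends on the conditioning.\<close>

lemma cgauss_linear_form_small_ball:
  assumes J: "finite J" "k \<in> J" and a: "a k \<noteq> 0" and t: "0 \<le> t"
  shows "emeasure (PiM J (\<lambda>_. cgauss 1))
      {y \<in> space (PiM J (\<lambda>_. cgauss 1)). cmod (\<Sum>i\<in>J. a i * y i) \<le> t}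
    \<le> ennreal ((t / cmod (a k))\<^sup>2)"
proof -
  interpret product_prob_space "\<lambda>_ :: 'a. cgauss 1" J
    by (rule product_prob_space_cgauss) simp
  let ?P = "\<lambda>J. PiM J (\<lambda>_ :: 'a. cgauss 1)"
  let ?A = "{y \<in> space (?P J). cmod (\<Sum>i\<in>J. a i * y i) \<le> t}"
  have J_eq: "(J - {k}) \<union> {k} = J" using J by auto
  have "emeasure (?P ((J - {k}) \<union> {k})) ?A \<le> ennreal ((t / cmod (a k))\<^sup>2)"
  proof (rule emeasure_PiM_le_slices)
    show "?A \<in> sets (?P ((J - {k}) \<union> {k}))"
      unfolding J_eq by measurable
    fix x assume x: "x \<in> space (?P (J - {k}))"
    define c where "c = - (\<Sum>i\<in>J - {k}. a i * x i) / a k"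
    have "{y \<in> space (?P {k}). merge (J - {k}) {k} (x, y) \<in> ?A}
      \<subseteq> PiE {k} (\<lambda>_. cball c (t / cmod (a k)))"
    proof
      fix y assume y: "y \<in> {y \<in> space (?P {k}). merge (J - {k}) {k} (x, y) \<in> ?A}"
      have "(\<Sum>i\<in>J. a i * merge (J - {k}) {k} (x, y) i) = a k * y k + (\<Sum>i\<in>J - {k}. a i * x i)"
        using J by (simp add: sum.remove[of J k])
      with y have "cmod (a k * y k + (\<Sum>i\<in>J - {k}. a i * x i)) \<le> t" by simp
      from affine_le_imp_cball[OF a this] y show "y \<in> PiE {k} (\<lambda>_. cball c (t / cmod (a k)))"
        by (auto simp: c_def space_PiM PiE_iff)
    qed
    then have "emeasure (?P {k}) {y \<in> space (?P {k}). merge (J - {k}) {k} (x, y) \<in> ?A}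
      \<le> emeasure (?P {k}) (PiE {k} (\<lambda>_. cball c (t / cmod (a k))))"
      by (intro emeasure_mono) (auto intro!: sets_PiM_I_finite)
    also have "\<dots> = emeasure (cgauss 1) (cball c (t / cmod (a k)))"
      by (subst emeasure_PiM) auto
    also have "\<dots> \<le> ennreal ((t / cmod (a k))\<^sup>2)"
      using emeasure_cgauss_cball_le[of 1 "t / cmod (a k)" c] t by simp
    finally show "emeasure (?P {k}) {y \<in> space (?P {k}). merge (J - {k}) {k} (x, y) \<in> ?A}
      \<le> ennreal ((t / cmod (a k))\<^sup>2)" .
  qed (use J in auto)
  then show ?thesis unfolding J_eq .
qed

text \<open>Condition on all columns except \<open>j0\<close>. Row \<open>i\<close> then puts the
  entry \<open>H (i, j0)\<close> into a disc of radius \<open>r / cmod (d j0)\<close>. The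
  \<open>N\<close> entries are independent, so the disc bounds multiply up to the exponent
  \<open>2 * N\<close>.\<close>

lemma cgauss_matrix_vector_small_ball:
  fixes M N j0 :: nat
  assumes j0: "j0 < M" "d j0 \<noteq> 0" and r: "0 \<le> r"
  shows "emeasure (PiM ({..<N} \<times> {..<M}) (\<lambda>_. cgauss 1))
      {H \<in> space (PiM ({..<N} \<times> {..<M}) (\<lambda>_. cgauss 1)).
        \<forall>i<N. cmod (\<Sum>j<M. H (i, j) * d j) \<le> r}
    \<le> ennreal ((r / cmod (d j0)) ^ (2 * N))"
proof -
  define K where "K = {..<N} \<times> ({..<M} - {j0})"
  define J where "J = {..<N} \<times> {j0}"
  have KJ: "K \<union> J = {..<N} \<times> {..<M}" using j0 by (auto simp: K_def J_def)
  interpret product_prob_space "\<lambda>_ :: nat \<times> nat. cgauss 1" J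
    by (rule product_prob_space_cgauss) simp
  let ?P = "\<lambda>J. PiM J (\<lambda>_ :: nat \<times> nat. cgauss 1)"
  let ?A = "{H \<in> space (?P (K \<union> J)). \<forall>i<N. cmod (\<Sum>j<M. H (i, j) * d j) \<le> r}"
  let ?t = "r / cmod (d j0)"
  have "emeasure (?P (K \<union> J)) ?A \<le> ennreal (?t ^ (2 * N))"
  proof (rule emeasure_PiM_le_slices)
    show "?A \<in> sets (?P (K \<union> J))"
      unfolding KJ by measurable
    fix x assume x: "x \<in> space (?P K)"
    define c where "c = (\<lambda>i. - (\<Sum>j\<in>{..<M} - {j0}. x (i, j) * d j) / d j0)"
    have "{y \<in> space (?P J). merge K J (x, y) \<in> ?A} \<subseteq> PiE J (\<lambda>p. cball (c (fst p)) ?t)"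
    proof
      fix y assume y: "y \<in> {y \<in> space (?P J). merge K J (x, y) \<in> ?A}"
      have "y (i, j0) \<in> cball (c i) ?t" if i: "i < N" for i
      proof -
        have "(\<Sum>j<M. merge K J (x, y) (i, j) * d j)
          = merge K J (x, y) (i, j0) * d j0 + (\<Sum>j\<in>{..<M} - {j0}. merge K J (x, y) (i, j) * d j)"
          using j0 by (simp add: sum.remove[of "{..<M}" j0])
        also have "(\<Sum>j\<in>{..<M} - {j0}. merge K J (x, y) (i, j) * d j)
          = (\<Sum>j\<in>{..<M} - {j0}. x (i, j) * d j)"
          using i by (intro sum.cong) (auto simp: merge_def K_def)
        also have "merge K J (x, y) (i, j0) = y (i, j0)"
          using i by (auto simp: merge_def K_def J_def)
        finally have "cmod (d j0 * y (i, j0) + (\<Sum>j\<in>{..<M} - {j0}. x (i, j) * d j)) \<le> r"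
          using y i by (simp add: mult.commute) metis
        from affine_le_imp_cball[OF j0(2) this] show ?thesis by (simp add: c_def)
      qed
      with y show "y \<in> PiE J (\<lambda>p. cball (c (fst p)) ?t)"
        by (auto simp: space_PiM PiE_iff J_def)
    qed
    then have "emeasure (?P J) {y \<in> space (?P J). merge K J (x, y) \<in> ?A}
      \<le> emeasure (?P J) (PiE J (\<lambda>p. cball (c (fst p)) ?t))"
      by (intro emeasure_mono) (auto intro!: sets_PiM_I_finite simp: J_def)
    also have "\<dots> = (\<Prod>p\<in>J. emeasure (cgauss 1) (cball (c (fst p)) ?t))"
      by (subst emeasure_PiM) (auto simp: J_def)
    also have "\<dots> \<le> (\<Prod>p\<in>J. ennreal (?t\<^sup>2))"
      using emeasure_cgauss_cball_le[of 1 ?t] r by (intro prod_mono_ennreal) simp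
    also have "\<dots> = ennreal (?t ^ (2 * N))"
      using r by (simp add: J_def card_cartesian_product ennreal_power power_mult)
    finally show "emeasure (?P J) {y \<in> space (?P J). merge K J (x, y) \<in> ?A}
      \<le> ennreal (?t ^ (2 * N))" .
  qed (auto simp: K_def J_def)
  then show ?thesis unfolding KJ .
qed

text \<open>A vector \<open>u\<close> orthogonal to the other columns (it exists because \<open>M \<le> N\<close>) reduces the
  event to \<open>|d\<^sub>j \<langle>u, h\<^sub>j\<rangle>| \<le> N r\<close> for the single column \<open>h\<^sub>j\<close>, uniformly over all \<open>d\<close>.\<close>
lemma cgauss_matrix_long_vector_small_ball:
  fixes M N j0 :: nat
  assumes j0: "j0 < M" and MN: "M \<le> N" and r: "0 \<le> r" and L: "0 < L" and D: "countable D"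
  shows "emeasure (PiM ({..<N} \<times> {..<M}) (\<lambda>_. cgauss 1))
      {H \<in> space (PiM ({..<N} \<times> {..<M}) (\<lambda>_. cgauss 1)).
        \<exists>d\<in>D. L \<le> cmod (d j0) \<and> (\<forall>i<N. cmod (\<Sum>j<M. H (i, j) * d j) \<le> r)}
    \<le> ennreal ((real N * r / L)\<^sup>2)"
proof -
  define K where "K = {..<N} \<times> ({..<M} - {j0})"
  define J where "J = {..<N} \<times> {j0}"
  have KJ: "K \<union> J = {..<N} \<times> {..<M}" using j0 by (auto simp: K_def J_def)
  interpret product_prob_space "\<lambda>_ :: nat \<times> nat. cgauss 1" J
    by (rule product_prob_space_cgauss) simp
  let ?P = "\<lambda>J. PiM J (\<lambda>_ :: nat \<times> nat. cgauss 1)"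
  let ?A = "{H \<in> space (?P (K \<union> J)).
    \<exists>d\<in>D. L \<le> cmod (d j0) \<and> (\<forall>i<N. cmod (\<Sum>j<M. H (i, j) * d j) \<le> r)}"
  let ?t = "real N * r / L"
  have "emeasure (?P (K \<union> J)) ?A \<le> ennreal (?t\<^sup>2)"
  proof (rule emeasure_PiM_le_slices)
    \<comment> \<open>Measurability: the event is a union over the countable set
      \<open>D\<close>.\<close>
    have "?A = (\<Union>d\<in>D. {H \<in> space (?P (K \<union> J)).
        L \<le> cmod (d j0) \<and> (\<forall>i<N. cmod (\<Sum>j<M. H (i, j) * d j) \<le> r)})" by auto
    also have "\<dots> \<in> sets (?P (K \<union> J))"
      unfolding KJ by (intro sets.countable_UN'' D) measurable
    finally show "?A \<in> sets (?P (K \<union> J))" .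
    fix x assume x: "x \<in> space (?P K)"
    \<comment> \<open>The columns other than \<open>j0\<close> give \<open>M - 1 < N\<close>
      equations in \<open>N\<close> unknowns, hence a nonzero solution.\<close>
    have "card ({..<M} - {j0}) < card {..<N}" using j0 MN by simp
    from underdetermined_system_nontrivial_solution[OF _ _ this, of "\<lambda>i j. x (i, j)"]
    obtain v where v: "\<exists>i<N. v i \<noteq> 0" "\<And>j. j < M \<Longrightarrow> j \<noteq> j0 \<Longrightarrow> (\<Sum>i<N. v i * x (i, j)) = 0"
      by auto
    have "\<exists>i0\<in>{..<N}. \<forall>i\<in>{..<N}. cmod (v i) \<le> cmod (v i0)"
      using v(1) by (intro ex_maximizer_finite) auto
    then obtain i0 where i0: "i0 < N" "\<And>i. i < N \<Longrightarrow> cmod (v i) \<le> cmod (v i0)" by auto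
    have vi0: "v i0 \<noteq> 0" using v(1) i0(2) by fastforce
    \<comment> \<open>Dividing by an entry of largest modulus keeps all weights at most 1 in
      modulus, so that summing over the rows costs only a factor \<open>N\<close>, and makes one
      weight equal to 1, at which the bound for linear forms is applied.\<close>
    define u where "u = (\<lambda>i. v i / v i0)"
    have u1: "u i0 = 1" and ule: "\<And>i. i < N \<Longrightarrow> cmod (u i) \<le> 1"
      using vi0 i0 by (auto simp: u_def norm_divide)
    have uorth: "(\<Sum>i<N. u i * x (i, j)) = 0" if "j < M" "j \<noteq> j0" for j
      using v(2)[OF that] by (simp add: u_def sum_divide_distrib [symmetric])
    let ?T = "{y \<in> space (?P J). cmod (\<Sum>p\<in>J. u (fst p) * y p) \<le> ?t}"
    have "{y \<in> space (?P J). merge K J (x, y) \<in> ?A} \<subseteq> ?T"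
    proof
      fix y assume y: "y \<in> {y \<in> space (?P J). merge K J (x, y) \<in> ?A}"
      let ?H = "merge K J (x, y)"
      from y obtain d where d: "d \<in> D" "L \<le> cmod (d j0)"
        "\<And>i. i < N \<Longrightarrow> cmod (\<Sum>j<M. ?H (i, j) * d j) \<le> r" by auto
      define S where "S = (\<Sum>i<N. u i * y (i, j0))"
      \<comment> \<open>With the sum over rows taken first, orthogonality removes every column but
        \<open>j0\<close>.\<close>
      have "(\<Sum>i<N. u i * (\<Sum>j<M. ?H (i, j) * d j)) = (\<Sum>j<M. d j * (\<Sum>i<N. u i * ?H (i, j)))"
        by (simp add: sum_distrib_left mult_ac) (rule sum.swap)
      also have "\<dots> = (\<Sum>j<M. if j = j0 then d j0 * S else 0)"
      proof (intro sum.cong refl)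
        fix j assume j: "j \<in> {..<M}"
        have "(\<Sum>i<N. u i * ?H (i, j)) = (if j = j0 then S else (\<Sum>i<N. u i * x (i, j)))"
          using j by (auto simp: S_def merge_def K_def J_def intro!: sum.cong)
        then show "d j * (\<Sum>i<N. u i * ?H (i, j)) = (if j = j0 then d j0 * S else 0)"
          using j uorth by auto
      qed
      also have "\<dots> = d j0 * S" using j0 by simp
      finally have "cmod (d j0) * cmod S = cmod (\<Sum>i<N. u i * (\<Sum>j<M. ?H (i, j) * d j))"
        by (simp add: norm_mult)
      also have "\<dots> \<le> (\<Sum>i<N. cmod (u i * (\<Sum>j<M. ?H (i, j) * d j)))"
        by (rule norm_sum)
      also have "\<dots> \<le> (\<Sum>i<N. 1 * r)"
        unfolding norm_mult using ule d(3) by (intro sum_mono mult_mono) auto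
      finally have "cmod (d j0) * cmod S \<le> real N * r" by simp
      moreover have "L * cmod S \<le> cmod (d j0) * cmod S"
        using d(2) by (intro mult_right_mono) auto
      ultimately have "cmod S \<le> ?t" using L by (simp add: field_simps)
      moreover have "(\<Sum>p\<in>J. u (fst p) * y p) = S"
        by (simp add: S_def J_def sum.cartesian_product')
      ultimately show "y \<in> ?T" using y by simp
    qed
    then have "emeasure (?P J) {y \<in> space (?P J). merge K J (x, y) \<in> ?A} \<le> emeasure (?P J) ?T"
      by (intro emeasure_mono) measurable
    also have "\<dots> \<le> ennreal ((?t / cmod (u (fst (i0, j0))))\<^sup>2)"
      using i0 u1 r L by (intro cgauss_linear_form_small_ball) (auto simp: J_def)
    also have "\<dots> = ennreal (?t\<^sup>2)" by (simp add: u1)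
    finally show "emeasure (?P J) {y \<in> space (?P J). merge K J (x, y) \<in> ?A} \<le> ennreal (?t\<^sup>2)" .
  qed (auto simp: K_def J_def)
  then show ?thesis unfolding KJ .
qed

subsection \<open>The error event\<close>

text \<open>Extensional functions: with the values outside \<open>{..<M}\<close> fixed, the set is
  countable and unions over it stay measurable.\<close>

definition gauss_vecs :: "nat \<Rightarrow> (nat \<Rightarrow> complex) set" where
  "gauss_vecs M = PiE {..<M} (\<lambda>_. {z. gauss_int z})"

text \<open>Here \<open>d\<close> plays the role of \<open>z - x\<close>, so that the transmitted
  vector no longer occurs.\<close>

definition confusable :: "nat \<Rightarrow> nat \<Rightarrow> (nat \<times> nat \<Rightarrow> complex) \<Rightarrow> (nat \<Rightarrow> complex) \<Rightarrow> bool" where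
  "confusable N M H w \<longleftrightarrow> (\<exists>d\<in>gauss_vecs M. (\<exists>j<M. d j \<noteq> 0) \<and>
     (\<Sum>i<N. (cmod (w i - (\<Sum>j<M. H (i, j) * d j)))\<^sup>2) \<le> (\<Sum>i<N. (cmod (w i))\<^sup>2))"

lemma countable_gauss_vecs: "countable (gauss_vecs M)"
proof -
  have "{z. gauss_int z} \<subseteq> (\<lambda>(a, b). Complex (of_int a) (of_int b)) ` UNIV"
  proof
    fix z assume "z \<in> {z. gauss_int z}"
    then obtain a b where "Re z = of_int a" "Im z = of_int b"
      by (auto simp: gauss_int_def elim!: Ints_cases)
    then have "z = (\<lambda>(a, b). Complex (of_int a) (of_int b)) (a, b)" by (simp add: complex_eq_iff)
    then show "z \<in> (\<lambda>(a, b). Complex (of_int a) (of_int b)) ` UNIV" by blast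
  qed
  then have "countable {z. gauss_int z}"
    by (rule countable_subset) simp
  then show ?thesis
    unfolding gauss_vecs_def by (intro countable_PiE) auto
qed

text \<open>The squared distance reads only coordinates below \<open>M\<close>, so \<open>z\<close>
  may be restricted to them. This turns the error event into a countable union.\<close>

lemma nld_error_iff_ex_gauss_vecs:
  "nld_error N M H x w \<longleftrightarrow> (\<exists>z\<in>gauss_vecs M. (\<exists>j<M. z j \<noteq> x j) \<and>
     sqdist_rx N M (chan_out N M H x w) H z \<le> sqdist_rx N M (chan_out N M H x w) H x)"
proof
  assume "nld_error N M H x w"
  then obtain z where z: "\<forall>j<M. gauss_int (z j)" "\<exists>j<M. z j \<noteq> x j"
    "sqdist_rx N M (chan_out N M H x w) H z \<le> sqdist_rx N M (chan_out N M H x w) H x"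
    by (auto simp: nld_error_def)
  have "sqdist_rx N M y H (restrict z {..<M}) = sqdist_rx N M y H z" for y
    by (simp add: sqdist_rx_def)
  with z show "\<exists>z\<in>gauss_vecs M. (\<exists>j<M. z j \<noteq> x j) \<and>
     sqdist_rx N M (chan_out N M H x w) H z \<le> sqdist_rx N M (chan_out N M H x w) H x"
    by (intro bexI[of _ "restrict z {..<M}"]) (auto simp: gauss_vecs_def)
qed (auto simp: nld_error_def gauss_vecs_def PiE_iff)

lemma gauss_int_add: "gauss_int a \<Longrightarrow> gauss_int b \<Longrightarrow> gauss_int (a + b)"
  and gauss_int_diff: "gauss_int a \<Longrightarrow> gauss_int b \<Longrightarrow> gauss_int (a - b)"
  by (auto simp: gauss_int_def)

text \<open>Substitute \<open>z = x + d\<close>. As \<open>x\<close> has Gaussian integer entries,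
  competing lattice points correspond to nonzero difference vectors in both directions, and the
  residual at \<open>z\<close> becomes the noise minus the image of \<open>d\<close>.\<close>

lemma nld_error_iff_confusable:
  assumes x: "\<forall>j<M. gauss_int (x j)"
  shows "nld_error N M H x w \<longleftrightarrow> confusable N M H w"
proof -
  have sq: "sqdist_rx N M (chan_out N M H x w) H z
    = (\<Sum>i<N. (cmod (w i - (\<Sum>j<M. H (i, j) * d j)))\<^sup>2)" if "\<And>j. j < M \<Longrightarrow> z j = x j + d j" for z d
  proof -
    have "chan_out N M H x w i - (\<Sum>j<M. H (i, j) * z j) = w i - (\<Sum>j<M. H (i, j) * d j)" for i
      using that by (simp add: chan_out_def distrib_left sum.distrib)
    then show ?thesis by (simp add: sqdist_rx_def)
  qed
  have sqx: "sqdist_rx N M (chan_out N M H x w) H x = (\<Sum>i<N. (cmod (w i))\<^sup>2)"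
    using sq[of x "\<lambda>_. 0"] by simp
  show ?thesis
  proof
    assume "nld_error N M H x w"
    then obtain z where z: "\<forall>j<M. gauss_int (z j)" "\<exists>j<M. z j \<noteq> x j"
      "sqdist_rx N M (chan_out N M H x w) H z \<le> sqdist_rx N M (chan_out N M H x w) H x"
      by (auto simp: nld_error_def)
    define d where "d = (\<lambda>j\<in>{..<M}. z j - x j)"
    have "d \<in> gauss_vecs M" using z x by (auto simp: gauss_vecs_def d_def gauss_int_diff)
    moreover have "\<exists>j<M. d j \<noteq> 0" using z(2) by (auto simp: d_def)
    moreover have "(\<Sum>i<N. (cmod (w i - (\<Sum>j<M. H (i, j) * d j)))\<^sup>2) \<le> (\<Sum>i<N. (cmod (w i))\<^sup>2)"
      using z(3) sq[of z d] sqx by (simp add: d_def)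
    ultimately show "confusable N M H w" unfolding confusable_def by blast
  next
    assume "confusable N M H w"
    then obtain d where d: "d \<in> gauss_vecs M" "\<exists>j<M. d j \<noteq> 0"
      "(\<Sum>i<N. (cmod (w i - (\<Sum>j<M. H (i, j) * d j)))\<^sup>2) \<le> (\<Sum>i<N. (cmod (w i))\<^sup>2)"
      by (auto simp: confusable_def)
    show "nld_error N M H x w"
      unfolding nld_error_def
      using d x sq[of "\<lambda>j. x j + d j" d] sqx
      by (intro exI[of _ "\<lambda>j. x j + d j"]) (auto simp: gauss_vecs_def PiE_iff gauss_int_add)
  qed
qed

text \<open>For a fixed lattice point the condition involves finitely many coordinates, each Borel
  measurable; for the transmitted entries this holds because every function on a pmf space is
  measurable.\<close>

lemma nld_error_sets:
  "{\<omega> \<in> space (mimo_space M N p s). nld_error N M (fst \<omega>) (fst (snd \<omega>)) (snd (snd \<omega>))}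
    \<in> sets (mimo_space M N p s)"
proof -
  let ?S = "mimo_space M N p s"
  have H [measurable]: "(\<lambda>\<omega>. fst \<omega> (i, j)) \<in> borel_measurable ?S" if "i < N" "j < M" for i j
  proof -
    have "(\<lambda>H. H (i, j)) \<in> borel_measurable (PiM ({..<N} \<times> {..<M}) (\<lambda>_. cgauss 1))"
      using measurable_component_singleton[of "(i, j)" "{..<N} \<times> {..<M}" "\<lambda>_. cgauss 1"] that
      by (simp cong: measurable_cong_sets)
    then show ?thesis unfolding mimo_space_def by measurable
  qed
  have x [measurable]: "(\<lambda>\<omega>. fst (snd \<omega>) j) \<in> borel_measurable ?S" if "j < M" for j
  proof -
    have "(\<lambda>x. x j) \<in> measurable (PiM {..<M} (\<lambda>j. measure_pmf (p j))) (measure_pmf (p j))"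
      using that by (intro measurable_component_singleton) simp
    then have "(\<lambda>x. x j) \<in> borel_measurable (PiM {..<M} (\<lambda>j. measure_pmf (p j)))"
      by (rule measurable_compose) simp
    then show ?thesis unfolding mimo_space_def by measurable
  qed
  have w [measurable]: "(\<lambda>\<omega>. snd (snd \<omega>) i) \<in> borel_measurable ?S" if "i < N" for i
  proof -
    have "(\<lambda>w. w i) \<in> borel_measurable (PiM {..<N} (\<lambda>_. cgauss s))"
      using measurable_component_singleton[of i "{..<N}" "\<lambda>_. cgauss s"] that
      by (simp cong: measurable_cong_sets)
    then show ?thesis unfolding mimo_space_def by measurable
  qed
  have "{\<omega> \<in> space ?S. nld_error N M (fst \<omega>) (fst (snd \<omega>)) (snd (snd \<omega>))}
    = (\<Union>z\<in>gauss_vecs M. {\<omega> \<in> space ?S. (\<exists>j\<in>{..<M}. z j \<noteq> fst (snd \<omega>) j) \<and>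
        sqdist_rx N M (chan_out N M (fst \<omega>) (fst (snd \<omega>)) (snd (snd \<omega>))) (fst \<omega>) z
        \<le> sqdist_rx N M (chan_out N M (fst \<omega>) (fst (snd \<omega>)) (snd (snd \<omega>))) (fst \<omega>) (fst (snd \<omega>))})"
    by (auto simp: nld_error_iff_ex_gauss_vecs)
  also have "\<dots> \<in> sets ?S"
    unfolding sqdist_rx_def chan_out_def
    by (intro sets.countable_UN'' countable_gauss_vecs) measurable
  finally show ?thesis .
qed

lemma confusable_sets:
  "{(H, w) \<in> space (PiM ({..<N} \<times> {..<M}) (\<lambda>_. cgauss 1) \<Otimes>\<^sub>M PiM {..<N} (\<lambda>_. cgauss s)).
      confusable N M H w}
    \<in> sets (PiM ({..<N} \<times> {..<M}) (\<lambda>_. cgauss 1) \<Otimes>\<^sub>M PiM {..<N} (\<lambda>_. cgauss s))"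
proof -
  let ?S = "PiM ({..<N} \<times> {..<M}) (\<lambda>_. cgauss 1) \<Otimes>\<^sub>M PiM {..<N} (\<lambda>_. cgauss s)"
  have H [measurable]: "(\<lambda>\<omega>. fst \<omega> (i, j)) \<in> borel_measurable ?S" if "i < N" "j < M" for i j
  proof -
    have "(\<lambda>H. H (i, j)) \<in> borel_measurable (PiM ({..<N} \<times> {..<M}) (\<lambda>_. cgauss 1))"
      using measurable_component_singleton[of "(i, j)" "{..<N} \<times> {..<M}" "\<lambda>_. cgauss 1"] that
      by (simp cong: measurable_cong_sets)
    then show ?thesis by measurable
  qed
  have w [measurable]: "(\<lambda>\<omega>. snd \<omega> i) \<in> borel_measurable ?S" if "i < N" for i
  proof -
    have "(\<lambda>w. w i) \<in> borel_measurable (PiM {..<N} (\<lambda>_. cgauss s))"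
      using measurable_component_singleton[of i "{..<N}" "\<lambda>_. cgauss s"] that
      by (simp cong: measurable_cong_sets)
    then show ?thesis by measurable
  qed
  have "{(H, w) \<in> space ?S. confusable N M H w}
    = (\<Union>d\<in>gauss_vecs M. {\<omega> \<in> space ?S. (\<exists>j<M. d j \<noteq> 0) \<and>
        (\<Sum>i<N. (cmod (snd \<omega> i - (\<Sum>j<M. fst \<omega> (i, j) * d j)))\<^sup>2) \<le> (\<Sum>i<N. (cmod (snd \<omega> i))\<^sup>2)})"
    by (auto simp: confusable_def)
  also have "\<dots> \<in> sets ?S"
    by (intro sets.countable_UN'' countable_gauss_vecs) measurable
  finally show ?thesis .
qed

text \<open>The product space also contains vectors outside the constellation; they form a null set
  because each coordinate has marginal \<open>p j\<close>.\<close>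

lemma AE_PiM_measure_pmf_set_pmf:
  assumes "finite I"
  shows "AE x in PiM I (\<lambda>j. measure_pmf (p j)). \<forall>j\<in>I. x j \<in> set_pmf (p j)"
proof (rule AE_finite_allI[OF assms])
  interpret product_prob_space "\<lambda>j. measure_pmf (p j)" I
    by (intro product_prob_spaceI measure_pmf.prob_space_axioms)
  fix j assume j: "j \<in> I"
  have "AE y in distr (PiM I (\<lambda>j. measure_pmf (p j))) (measure_pmf (p j)) (\<lambda>x. x j). y \<in> set_pmf (p j)"
    unfolding PiM_component[OF j] by (rule AE_measure_pmf)
  then show "AE x in PiM I (\<lambda>j. measure_pmf (p j)). x j \<in> set_pmf (p j)"
    using j by (subst (asm) AE_distr_iff) auto
qed

text \<open>For fixed \<open>H\<close> almost every \<open>x\<close> yields the same noise event, so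
  \<open>x\<close> integrates out. Exchanging the remaining integrals puts the noise outside: the
  bounds to come fix \<open>w\<close> and use only the randomness of \<open>H\<close>.\<close>

lemma emeasure_nld_error:
  assumes s: "0 < s" and p: "\<forall>j<M. \<forall>c\<in>set_pmf (p j). gauss_int c"
  shows "emeasure (mimo_space M N p s)
      {\<omega> \<in> space (mimo_space M N p s). nld_error N M (fst \<omega>) (fst (snd \<omega>)) (snd (snd \<omega>))}
    = (\<integral>\<^sup>+w. emeasure (PiM ({..<N} \<times> {..<M}) (\<lambda>_. cgauss 1))
        {H \<in> space (PiM ({..<N} \<times> {..<M}) (\<lambda>_. cgauss 1)). confusable N M H w}
        \<partial>PiM {..<N} (\<lambda>_. cgauss s))"
proof -
  let ?A = "PiM ({..<N} \<times> {..<M}) (\<lambda>_. cgauss 1)"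
  let ?B = "PiM {..<M} (\<lambda>j. measure_pmf (p j))"
  let ?W = "PiM {..<N} (\<lambda>_. cgauss s)"
  let ?E = "{\<omega> \<in> space (mimo_space M N p s). nld_error N M (fst \<omega>) (fst (snd \<omega>)) (snd (snd \<omega>))}"
  let ?Q = "{(H, w) \<in> space (?A \<Otimes>\<^sub>M ?W). confusable N M H w}"
  interpret A: prob_space ?A by (intro prob_space_PiM prob_space_cgauss) simp
  interpret B: prob_space ?B by (intro prob_space_PiM measure_pmf.prob_space_axioms)
  interpret W: prob_space ?W by (intro prob_space_PiM prob_space_cgauss s)
  interpret BW: pair_prob_space ?B ?W ..
  interpret AW: pair_prob_space ?A ?W ..
  have E: "?E \<in> sets (?A \<Otimes>\<^sub>M ?B \<Otimes>\<^sub>M ?W)"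
    using nld_error_sets[of M N p s] by (simp add: mimo_space_def)
  have Q: "?Q \<in> sets (?A \<Otimes>\<^sub>M ?W)" by (rule confusable_sets)
  have slice: "emeasure (?B \<Otimes>\<^sub>M ?W) (Pair H -` ?E) = emeasure ?W (Pair H -` ?Q)" if H: "H \<in> space ?A" for H
  proof -
    have "emeasure (?B \<Otimes>\<^sub>M ?W) (Pair H -` ?E) = (\<integral>\<^sup>+x. emeasure ?W (Pair x -` (Pair H -` ?E)) \<partial>?B)"
      using E by (intro W.emeasure_pair_measure_alt sets_Pair1)
    also have "\<dots> = (\<integral>\<^sup>+x. emeasure ?W (Pair H -` ?Q) \<partial>?B)"
    proof (intro nn_integral_cong_AE)
      have "AE x in ?B. \<forall>j<M. gauss_int (x j)"
        using AE_PiM_measure_pmf_set_pmf[of "{..<M}" p] p by (auto elim!: eventually_mono)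
      then show "AE x in ?B. emeasure ?W (Pair x -` (Pair H -` ?E)) = emeasure ?W (Pair H -` ?Q)"
      proof (rule AE_mp, intro AE_I2 impI)
        fix x assume x: "x \<in> space ?B" "\<forall>j<M. gauss_int (x j)"
        have "Pair x -` (Pair H -` ?E) = Pair H -` ?Q"
          using x H nld_error_iff_confusable[OF x(2)]
          by (auto simp: mimo_space_def space_pair_measure)
        then show "emeasure ?W (Pair x -` (Pair H -` ?E)) = emeasure ?W (Pair H -` ?Q)" by simp
      qed
    qed
    also have "\<dots> = emeasure ?W (Pair H -` ?Q)" by (simp add: B.emeasure_space_1)
    finally show ?thesis .
  qed
  have "emeasure (mimo_space M N p s) ?E = (\<integral>\<^sup>+H. emeasure (?B \<Otimes>\<^sub>M ?W) (Pair H -` ?E) \<partial>?A)"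
    unfolding mimo_space_def[of M N p s]
    using E unfolding mimo_space_def[of M N p s] by (rule BW.emeasure_pair_measure_alt)
  also have "\<dots> = (\<integral>\<^sup>+H. emeasure ?W (Pair H -` ?Q) \<partial>?A)"
    by (intro nn_integral_cong slice)
  also have "\<dots> = emeasure (?A \<Otimes>\<^sub>M ?W) ?Q"
    using Q by (rule W.emeasure_pair_measure_alt [symmetric])
  also have "\<dots> = (\<integral>\<^sup>+w. emeasure ?A ((\<lambda>H. (H, w)) -` ?Q) \<partial>?W)"
    using Q by (rule AW.emeasure_pair_measure_alt2)
  also have "\<dots> = (\<integral>\<^sup>+w. emeasure ?A {H \<in> space ?A. confusable N M H w} \<partial>?W)"
    by (intro nn_integral_cong arg_cong2[where f = emeasure]) (auto simp: space_pair_measure)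
  finally show ?thesis .
qed

subsection \<open>Lower bound\<close>

lemma confusable_slice_sets:
  assumes "w \<in> space (PiM {..<N} (\<lambda>_. cgauss s))"
  shows "{H \<in> space (PiM ({..<N} \<times> {..<M}) (\<lambda>_. cgauss 1)). confusable N M H w}
    \<in> sets (PiM ({..<N} \<times> {..<M}) (\<lambda>_. cgauss 1))"
proof -
  have "{H \<in> space (PiM ({..<N} \<times> {..<M}) (\<lambda>_. cgauss 1)). confusable N M H w}
    = (\<lambda>H. (H, w)) -` {(H, w) \<in> space (PiM ({..<N} \<times> {..<M}) (\<lambda>_. cgauss 1) \<Otimes>\<^sub>M
        PiM {..<N} (\<lambda>_. cgauss s)). confusable N M H w}"
    using assms by (auto simp: space_pair_measure)
  then show ?thesis using sets_Pair2[OF confusable_sets] by simp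
qed

text \<open>The integrand is the lower bound for the mass under \<open>cgauss 1\<close> of the disc
  with centre \<open>z\<close> and radius \<open>cmod z\<close>. On the disc of radius
  \<open>sqrt s\<close> about \<open>2 * sqrt s\<close> the modulus lies between
  \<open>sqrt s\<close> and \<open>3 * sqrt s\<close>, so the integrand is at least
  \<open>s * exp (- 36)\<close> for \<open>s\<close> at most 1. That disc has mass at least
  \<open>exp (- 9)\<close>, and \<open>45 = 36 + 9\<close>.\<close>

lemma cgauss_weighted_second_moment_ge:
  assumes s: "0 < s" "s \<le> 1"
  shows "ennreal (exp (- 45) * s) \<le>
    (\<integral>\<^sup>+z. ennreal ((cmod z)\<^sup>2 * exp (- (2 * cmod z)\<^sup>2)) \<partial>cgauss s)"
proof -
  let ?B = "cball (complex_of_real (2 * sqrt s)) (sqrt s)"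
  have "ennreal (exp (- 45) * s) = ennreal (s * exp (- 36)) * ennreal (exp (- 9))"
    using s by (simp add: ennreal_mult [symmetric] exp_add [symmetric] mult.commute mult.left_commute)
  also have "\<dots> \<le> ennreal (s * exp (- 36)) * emeasure (cgauss s) ?B"
  proof (intro mult_left_mono)
    have "(sqrt s)\<^sup>2 * exp (- (cmod (complex_of_real (2 * sqrt s)) + sqrt s)\<^sup>2 / s) / s = exp (- 9)"
      using s by (simp add: norm_mult power_mult_distrib)
    with emeasure_cgauss_cball_ge[of s "sqrt s" "complex_of_real (2 * sqrt s)"] s
    show "ennreal (exp (- 9)) \<le> emeasure (cgauss s) ?B" by simp
  qed simp
  also have "\<dots> = (\<integral>\<^sup>+z. ennreal (s * exp (- 36)) * indicator ?B z \<partial>cgauss s)"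
    by (subst nn_integral_cmult_indicator) auto
  also have "\<dots> \<le> (\<integral>\<^sup>+z. ennreal ((cmod z)\<^sup>2 * exp (- (2 * cmod z)\<^sup>2)) \<partial>cgauss s)"
  proof (intro nn_integral_mono)
    fix z
    have "s * exp (- 36) \<le> (cmod z)\<^sup>2 * exp (- (2 * cmod z)\<^sup>2)" if z: "z \<in> ?B"
    proof -
      have d: "cmod (complex_of_real (2 * sqrt s) - z) \<le> sqrt s" using z by (simp add: dist_norm)
      have n: "cmod (complex_of_real (2 * sqrt s)) = 2 * sqrt s" using s by (simp add: norm_mult)
      have lo: "sqrt s \<le> cmod z"
        using norm_triangle_ineq2[of "complex_of_real (2 * sqrt s)" z] d n by simp
      have hi: "cmod z \<le> 3 * sqrt s"
        using norm_triangle_ineq2[of z "complex_of_real (2 * sqrt s)"] d n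
        by (simp add: norm_minus_commute)
      have "s \<le> (cmod z)\<^sup>2" using power_mono[OF lo, of 2] s by simp
      moreover have "(2 * cmod z)\<^sup>2 \<le> (6 * sqrt s)\<^sup>2" using hi by (intro power_mono) auto
      then have "(2 * cmod z)\<^sup>2 \<le> 36" using s by (simp add: power_mult_distrib)
      ultimately show ?thesis using s by (intro mult_mono) auto
    qed
    then show "ennreal (s * exp (- 36)) * indicator ?B z \<le> ennreal ((cmod z)\<^sup>2 * exp (- (2 * cmod z)\<^sup>2))"
      by (auto simp: indicator_def intro!: ennreal_leI)
  qed
  finally show ?thesis .
qed

text \<open>The difference vector with 1 at coordinate 0 and 0 elsewhere already causes an error
  when every \<open>H (i, 0)\<close> lies in the disc with centre \<open>w i\<close> and radius
  \<open>cmod (w i)\<close>. These events are independent, and the lower disc bound applies to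
  each.\<close>

lemma emeasure_confusable_ge:
  assumes M: "1 \<le> M" and w: "w \<in> space (PiM {..<N} (\<lambda>_. cgauss s))"
  shows "(\<Prod>i<N. ennreal ((cmod (w i))\<^sup>2 * exp (- (2 * cmod (w i))\<^sup>2)))
    \<le> emeasure (PiM ({..<N} \<times> {..<M}) (\<lambda>_. cgauss 1))
        {H \<in> space (PiM ({..<N} \<times> {..<M}) (\<lambda>_. cgauss 1)). confusable N M H w}"
proof -
  let ?A = "PiM ({..<N} \<times> {..<M}) (\<lambda>_. cgauss 1)"
  interpret product_prob_space "\<lambda>_ :: nat \<times> nat. cgauss 1" "{..<N} \<times> {..<M}"
    by (rule product_prob_space_cgauss) simp
  let ?X = "\<lambda>p :: nat \<times> nat. cball (w (fst p)) (cmod (w (fst p)))"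
  let ?S = "{H \<in> space ?A. \<forall>p\<in>{..<N} \<times> {0}. H p \<in> ?X p}"
  have "(\<Prod>i<N. ennreal ((cmod (w i))\<^sup>2 * exp (- (2 * cmod (w i))\<^sup>2)))
    \<le> (\<Prod>i<N. emeasure (cgauss 1) (cball (w i) (cmod (w i))))"
  proof (intro prod_mono_ennreal)
    fix i
    show "ennreal ((cmod (w i))\<^sup>2 * exp (- (2 * cmod (w i))\<^sup>2))
      \<le> emeasure (cgauss 1) (cball (w i) (cmod (w i)))"
      using emeasure_cgauss_cball_ge[of 1 "cmod (w i)" "w i"] by simp
  qed
  also have "\<dots> = (\<Prod>p\<in>{..<N} \<times> {0}. emeasure (cgauss 1) (?X p))"
    by (simp add: prod.cartesian_product')
  also have "\<dots> = emeasure ?A ?S"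
    using M by (intro emeasure_PiM_Collect [symmetric]) auto
  also have "\<dots> \<le> emeasure ?A {H \<in> space ?A. confusable N M H w}"
  proof (rule emeasure_mono)
    show "?S \<subseteq> {H \<in> space ?A. confusable N M H w}"
    proof safe
      fix H assume H: "\<forall>p\<in>{..<N} \<times> {0}. H p \<in> ?X p"
      define d :: "nat \<Rightarrow> complex" where "d = (\<lambda>j\<in>{..<M}. if j = 0 then 1 else 0)"
      have "(\<Sum>j<M. H (i, j) * d j) = H (i, 0)" for i
      proof -
        have "(\<Sum>j<M. H (i, j) * d j) = (\<Sum>j<M. if j = 0 then H (i, 0) else 0)"
          by (intro sum.cong) (auto simp: d_def)
        then show ?thesis using M by simp
      qed
      then have "(\<Sum>i<N. (cmod (w i - (\<Sum>j<M. H (i, j) * d j)))\<^sup>2) \<le> (\<Sum>i<N. (cmod (w i))\<^sup>2)"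
        using H by (auto simp: dist_norm intro!: sum_mono power_mono)
      moreover have "d \<in> gauss_vecs M" by (auto simp: d_def gauss_vecs_def gauss_int_def)
      moreover have "\<exists>j<M. d j \<noteq> 0" using M by (intro exI[of _ 0]) (auto simp: d_def)
      ultimately show "confusable N M H w" unfolding confusable_def by blast
    qed
  qed (rule confusable_slice_sets[OF w])
  finally show ?thesis .
qed

text \<open>The pointwise lower bound is a product over the receive antennas, so independence of the
  noise entries turns its integral into a product of \<open>N\<close> equal factors.\<close>

lemma nn_integral_confusable_ge:
  assumes M: "1 \<le> M" and s: "0 < s" "s \<le> 1"
  shows "ennreal ((exp (- 45) * s) ^ N)
    \<le> (\<integral>\<^sup>+w. emeasure (PiM ({..<N} \<times> {..<M}) (\<lambda>_. cgauss 1))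
        {H \<in> space (PiM ({..<N} \<times> {..<M}) (\<lambda>_. cgauss 1)). confusable N M H w}
        \<partial>PiM {..<N} (\<lambda>_. cgauss s))"
proof -
  interpret product_prob_space "\<lambda>_ :: nat. cgauss s" "{..<N}"
    by (rule product_prob_space_cgauss) (rule s)
  let ?g = "\<lambda>z. ennreal ((cmod z)\<^sup>2 * exp (- (2 * cmod z)\<^sup>2))"
  have "ennreal ((exp (- 45) * s) ^ N) = (\<Prod>i<N. ennreal (exp (- 45) * s))"
    using s by (simp add: ennreal_power)
  also have "\<dots> \<le> (\<Prod>i<N. \<integral>\<^sup>+z. ?g z \<partial>cgauss s)"
    using cgauss_weighted_second_moment_ge[OF s] by (intro prod_mono_ennreal)
  also have "\<dots> = (\<integral>\<^sup>+w. (\<Prod>i<N. ?g (w i)) \<partial>PiM {..<N} (\<lambda>_. cgauss s))"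
    by (intro product_nn_integral_prod [symmetric]) (auto simp: measurable_cong_sets[OF sets_cgauss refl])
  also have "\<dots> \<le> (\<integral>\<^sup>+w. emeasure (PiM ({..<N} \<times> {..<M}) (\<lambda>_. cgauss 1))
        {H \<in> space (PiM ({..<N} \<times> {..<M}) (\<lambda>_. cgauss 1)). confusable N M H w}
        \<partial>PiM {..<N} (\<lambda>_. cgauss s))"
    using M by (intro nn_integral_mono emeasure_confusable_ge)
  finally show ?thesis .
qed

subsection \<open>Upper bound\<close>

text \<open>A square rather than a disc, so that sums over it split into sums over real and
  imaginary parts.\<close>

definition gauss_box :: "nat \<Rightarrow> complex set" where
  "gauss_box L = (\<lambda>(a, b). Complex (of_int a) (of_int b)) ` ({- int L..int L} \<times> {- int L..int L})"

lemma finite_gauss_box: "finite (gauss_box L)"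
  by (simp add: gauss_box_def)

lemma gauss_int_outside_box:
  assumes "gauss_int z" "z \<notin> gauss_box L"
  shows "real L \<le> cmod z"
proof (rule ccontr)
  assume *: "\<not> real L \<le> cmod z"
  from assms(1) obtain a b where ab: "Re z = of_int a" "Im z = of_int b"
    by (auto simp: gauss_int_def elim!: Ints_cases)
  have "\<bar>real_of_int a\<bar> \<le> real L" "\<bar>real_of_int b\<bar> \<le> real L"
    using abs_Re_le_cmod[of z] abs_Im_le_cmod[of z] * ab by auto
  then have "a \<in> {- int L..int L}" "b \<in> {- int L..int L}" by auto
  moreover have "z = (\<lambda>(a, b). Complex (of_int a) (of_int b)) (a, b)"
    using ab by (simp add: complex_eq_iff)
  ultimately have "z \<in> gauss_box L" unfolding gauss_box_def by blast
  with assms(2) show False by simp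
qed

lemma gauss_int_norm_ge_1:
  assumes "gauss_int z" "z \<noteq> 0"
  shows "1 \<le> cmod z"
proof -
  from assms(1) obtain a b where ab: "Re z = of_int a" "Im z = of_int b"
    by (auto simp: gauss_int_def elim!: Ints_cases)
  with assms(2) have "a \<noteq> 0 \<or> b \<noteq> 0" by (auto simp: complex_eq_iff)
  then have "1 \<le> \<bar>real_of_int a\<bar> \<or> 1 \<le> \<bar>real_of_int b\<bar>" by linarith
  then show ?thesis using abs_Re_le_cmod[of z] abs_Im_le_cmod[of z] ab by auto
qed

section \<open>Logarithmic growth of the lattice sum over a box\<close>

lemma sum_inverse_abs_int:
  "(\<Sum>a\<in>{- int L..int L}. 1 / max 1 \<bar>real_of_int a\<bar>) = 1 + 2 * harm L"
proof (induction L)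
  case (Suc L)
  have "{- int (Suc L)..int (Suc L)} = insert (int (Suc L)) (insert (- int (Suc L)) {- int L..int L})"
    by auto
  then show ?case using Suc by (simp add: harm_Suc field_simps)
qed (simp add: harm_expand)

text \<open>The harmonic number minus the logarithm is decreasing and starts at 1.\<close>

lemma harm_le_ln_plus_1:
  assumes "1 \<le> L"
  shows "harm L \<le> 1 + ln (real L)"
proof -
  obtain n where n: "L = Suc n" using assms by (cases L) auto
  have "harm (Suc n) - ln (real (Suc n)) \<le> harm (Suc 0) - ln (real (Suc 0))"
    using decseqD[OF decseq_harm_diff_ln, of 0 n] by simp
  then show ?thesis by (simp add: n harm_expand)
qed

text \<open>The modulus dominates both the real and the imaginary part, so
  \<open>(max 1 (cmod z))^2\<close> dominates the product of the two one-dimensional weights and the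
  sum splits into two harmonic sums.\<close>

lemma sum_gauss_box_le:
  "(\<Sum>z\<in>gauss_box L. 1 / (max 1 (cmod z))\<^sup>2) \<le> (1 + 2 * harm L)\<^sup>2"
proof -
  let ?S = "{- int L..int L}"
  let ?f = "\<lambda>z. 1 / (max 1 (cmod z))\<^sup>2"
  have "(\<Sum>z\<in>gauss_box L. ?f z) \<le> (\<Sum>p\<in>?S \<times> ?S. ?f ((\<lambda>(a, b). Complex (of_int a) (of_int b)) p))"
    unfolding gauss_box_def using sum_image_le[of "?S \<times> ?S" ?f "\<lambda>(a, b). Complex (of_int a) (of_int b)"]
    by (simp add: comp_def)
  also have "\<dots> \<le> (\<Sum>p\<in>?S \<times> ?S. 1 / max 1 \<bar>real_of_int (fst p)\<bar> * (1 / max 1 \<bar>real_of_int (snd p)\<bar>))"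
  proof (rule sum_mono, clarify)
    fix a b :: int
    let ?z = "Complex (of_int a) (of_int b)"
    have "max 1 \<bar>real_of_int a\<bar> * max 1 \<bar>real_of_int b\<bar> \<le> max 1 (cmod ?z) * max 1 (cmod ?z)"
      using abs_Re_le_cmod[of ?z] abs_Im_le_cmod[of ?z] by (intro mult_mono) auto
    moreover have "0 < max 1 \<bar>real_of_int a\<bar> * max 1 \<bar>real_of_int b\<bar>"
      by (intro mult_pos_pos) auto
    ultimately have "1 / (max 1 (cmod ?z) * max 1 (cmod ?z)) \<le> 1 / (max 1 \<bar>real_of_int a\<bar> * max 1 \<bar>real_of_int b\<bar>)"
      by (intro divide_left_mono mult_pos_pos) auto
    then show "?f ?z \<le> 1 / max 1 \<bar>real_of_int (fst (a, b))\<bar> * (1 / max 1 \<bar>real_of_int (snd (a, b))\<bar>)"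
      by (simp add: power2_eq_square)
  qed
  also have "\<dots> = (\<Sum>a\<in>?S. 1 / max 1 \<bar>real_of_int a\<bar>) * (\<Sum>b\<in>?S. 1 / max 1 \<bar>real_of_int b\<bar>)"
    unfolding sum_product sum.cartesian_product by (intro sum.cong) auto
  finally show ?thesis by (simp add: sum_inverse_abs_int power2_eq_square)
qed

text \<open>The weight is a product over coordinates, so the sum over the product set is an
  \<open>M\<close>-th power of the sum over one box.\<close>

lemma sum_box_vectors_le:
  "(\<Sum>d\<in>PiE {..<M} (\<lambda>_. gauss_box L). \<Prod>j<M. 1 / (max 1 (cmod (d j)))\<^sup>2) \<le> (1 + 2 * harm L) ^ (2 * M)"
proof -
  have "(\<Sum>d\<in>PiE {..<M} (\<lambda>_. gauss_box L). \<Prod>j<M. 1 / (max 1 (cmod (d j)))\<^sup>2)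
    = (\<Prod>j<M. \<Sum>z\<in>gauss_box L. 1 / (max 1 (cmod z))\<^sup>2)"
    by (intro prod_sum_PiE [symmetric]) (auto simp: finite_gauss_box)
  also have "\<dots> = (\<Sum>z\<in>gauss_box L. 1 / (max 1 (cmod z))\<^sup>2) ^ M" by simp
  also have "\<dots> \<le> ((1 + 2 * harm L)\<^sup>2) ^ M"
    by (intro power_mono sum_gauss_box_le sum_nonneg) auto
  finally show ?thesis by (simp add: power_mult)
qed

text \<open>The entries of \<open>w\<close> and of \<open>w - v\<close> are all bounded by the sum
  of the moduli of \<open>w\<close>, which dominates its Euclidean norm; the triangle inequality
  gives the factor 2.\<close>

lemma confusion_imp_small_image:
  fixes N :: nat
  assumes le: "(\<Sum>i<N. (cmod (w i - v i))\<^sup>2) \<le> (\<Sum>i<N. (cmod (w i))\<^sup>2)" and i: "i < N"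
  shows "cmod (v i) \<le> 2 * (\<Sum>i<N. cmod (w i))"
proof -
  let ?S = "\<Sum>i<N. cmod (w i)"
  have S: "0 \<le> ?S" by (intro sum_nonneg) auto
  have "(cmod (w i - v i))\<^sup>2 \<le> (\<Sum>i<N. (cmod (w i - v i))\<^sup>2)"
    using i by (intro member_le_sum) auto
  also note le
  also have "(\<Sum>i<N. (cmod (w i))\<^sup>2) \<le> (\<Sum>i<N. cmod (w i) * ?S)"
    unfolding power2_eq_square by (intro sum_mono mult_left_mono member_le_sum) auto
  also have "\<dots> = ?S\<^sup>2" by (simp add: power2_eq_square sum_distrib_right)
  finally have "cmod (w i - v i) \<le> ?S" using S by (rule power2_le_imp_le)
  moreover have "cmod (w i) \<le> ?S" using i by (intro member_le_sum) auto
  moreover have "cmod (v i) \<le> cmod (w i) + cmod (w i - v i)"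
    using norm_triangle_ineq4[of "w i" "w i - v i"] by simp
  ultimately show ?thesis by simp
qed

text \<open>Apply the fixed-vector bound at an entry of largest modulus. Being a nonzero Gaussian
  integer, it has modulus at least 1, so \<open>M \<le> N\<close> lets its power
  \<open>2 * N\<close> dominate the product over all \<open>M\<close> entries. The product form is
  what can be summed over boxes.\<close>

lemma cgauss_matrix_box_vector_small_ball:
  assumes MN: "M \<le> N" and r: "0 \<le> r" and d: "d \<in> gauss_vecs M" "\<exists>j<M. d j \<noteq> 0"
  shows "emeasure (PiM ({..<N} \<times> {..<M}) (\<lambda>_. cgauss 1))
      {H \<in> space (PiM ({..<N} \<times> {..<M}) (\<lambda>_. cgauss 1)).
        \<forall>i<N. cmod (\<Sum>j<M. H (i, j) * d j) \<le> r}
    \<le> ennreal (r ^ (2 * N) * (\<Prod>j<M. 1 / (max 1 (cmod (d j)))\<^sup>2))"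
proof -
  have "\<exists>k\<in>{..<M}. \<forall>j\<in>{..<M}. cmod (d j) \<le> cmod (d k)"
    using d(2) by (intro ex_maximizer_finite) auto
  then obtain k where k: "k < M" "\<And>j. j < M \<Longrightarrow> cmod (d j) \<le> cmod (d k)" by auto
  have dk0: "d k \<noteq> 0" using d(2) k(2) by fastforce
  have "gauss_int (d k)" using d(1) k(1) by (auto simp: gauss_vecs_def)
  then have dk1: "1 \<le> cmod (d k)" using dk0 by (rule gauss_int_norm_ge_1)
  have "(\<Prod>j<M. (max 1 (cmod (d j)))\<^sup>2) \<le> (\<Prod>j<M. (cmod (d k))\<^sup>2)"
    using k dk1 by (intro prod_mono) (auto intro!: power_mono)
  also have "\<dots> = cmod (d k) ^ (2 * M)" by (simp add: power_mult)
  also have "\<dots> \<le> cmod (d k) ^ (2 * N)" using dk1 MN by (intro power_increasing) auto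
  finally have "r ^ (2 * N) / cmod (d k) ^ (2 * N) \<le> r ^ (2 * N) / (\<Prod>j<M. (max 1 (cmod (d j)))\<^sup>2)"
    using r dk0 by (intro divide_left_mono mult_pos_pos prod_pos) auto
  then have "(r / cmod (d k)) ^ (2 * N) \<le> r ^ (2 * N) * (\<Prod>j<M. 1 / (max 1 (cmod (d j)))\<^sup>2)"
    by (simp add: power_divide prod_dividef)
  then show ?thesis
    using cgauss_matrix_vector_small_ball[of k M d r N] k(1) dk0 r
    by (meson ennreal_leI order_trans)
qed

text \<open>Union bound. The finitely many vectors with all entries in the box are summed one by one
  (\<open>S\<close>). The others are grouped by a coordinate \<open>k\<close> of modulus at least
  \<open>L\<close>, and each group is treated as a single event (\<open>T\<close>), so no infinite
  lattice sum is formed.\<close>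

lemma emeasure_confusable_le:
  assumes MN: "M \<le> N" and L: "1 \<le> L" and w: "w \<in> space (PiM {..<N} (\<lambda>_. cgauss s))"
  defines "r \<equiv> 2 * (\<Sum>i<N. cmod (w i))"
  shows "emeasure (PiM ({..<N} \<times> {..<M}) (\<lambda>_. cgauss 1))
      {H \<in> space (PiM ({..<N} \<times> {..<M}) (\<lambda>_. cgauss 1)). confusable N M H w}
    \<le> ennreal ((1 + 2 * harm L) ^ (2 * M) * r ^ (2 * N) + real M * (real N / real L)\<^sup>2 * r ^ 2)"
proof -
  let ?A = "PiM ({..<N} \<times> {..<M}) (\<lambda>_. cgauss 1)"
  have r: "0 \<le> r" unfolding r_def by (intro mult_nonneg_nonneg sum_nonneg) auto
  define D where "D = {d \<in> PiE {..<M} (\<lambda>_. gauss_box L). d \<in> gauss_vecs M \<and> (\<exists>j<M. d j \<noteq> 0)}"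
  have finD: "finite D"
    unfolding D_def by (rule finite_subset[of _ "PiE {..<M} (\<lambda>_. gauss_box L)"])
      (auto intro: finite_PiE finite_gauss_box)
  define S where "S = (\<lambda>d. {H \<in> space ?A. \<forall>i<N. cmod (\<Sum>j<M. H (i, j) * d j) \<le> r})"
  define T where "T = (\<lambda>k. {H \<in> space ?A. \<exists>d\<in>gauss_vecs M. real L \<le> cmod (d k) \<and>
    (\<forall>i<N. cmod (\<Sum>j<M. H (i, j) * d j) \<le> r)})"
  have S_sets: "S d \<in> sets ?A" for d
    unfolding S_def by measurable
  have T_sets: "T k \<in> sets ?A" for k
  proof -
    have "T k = (\<Union>d\<in>{d \<in> gauss_vecs M. real L \<le> cmod (d k)}. S d)"
      unfolding T_def S_def by auto
    moreover have "countable {d \<in> gauss_vecs M. real L \<le> cmod (d k)}"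
      by (rule countable_subset[OF _ countable_gauss_vecs[of M]]) auto
    ultimately show ?thesis using S_sets by (auto intro!: sets.countable_UN'')
  qed
  have "{H \<in> space ?A. confusable N M H w} \<subseteq> (\<Union>d\<in>D. S d) \<union> (\<Union>k<M. T k)"
  proof safe
    fix H assume H: "H \<in> space ?A" "confusable N M H w" "H \<notin> (\<Union>k<M. T k)"
    then obtain d where d: "d \<in> gauss_vecs M" "\<exists>j<M. d j \<noteq> 0"
      "(\<Sum>i<N. (cmod (w i - (\<Sum>j<M. H (i, j) * d j)))\<^sup>2) \<le> (\<Sum>i<N. (cmod (w i))\<^sup>2)"
      by (auto simp: confusable_def)
    have small: "\<forall>i<N. cmod (\<Sum>j<M. H (i, j) * d j) \<le> r"
      using confusion_imp_small_image[OF d(3)] by (simp add: r_def)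
    have "d k \<in> gauss_box L" if "k < M" for k
    proof (rule ccontr)
      assume "d k \<notin> gauss_box L"
      moreover have "gauss_int (d k)" using d(1) that by (auto simp: gauss_vecs_def)
      ultimately have "real L \<le> cmod (d k)" by (intro gauss_int_outside_box)
      then have "H \<in> T k" unfolding T_def using H(1) d(1) small by blast
      with H(3) that show False by auto
    qed
    then have "d \<in> D" using d by (auto simp: D_def gauss_vecs_def PiE_iff)
    moreover have "H \<in> S d" using H(1) small by (simp add: S_def)
    ultimately show "H \<in> (\<Union>d\<in>D. S d)" by blast
  qed
  then have "emeasure ?A {H \<in> space ?A. confusable N M H w}
    \<le> emeasure ?A ((\<Union>d\<in>D. S d) \<union> (\<Union>k<M. T k))"
    using S_sets T_sets finD by (intro emeasure_mono sets.Un sets.finite_UN) auto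
  also have "\<dots> \<le> emeasure ?A (\<Union>d\<in>D. S d) + emeasure ?A (\<Union>k<M. T k)"
    using S_sets T_sets finD by (intro emeasure_subadditive sets.finite_UN) auto
  also have "\<dots> \<le> (\<Sum>d\<in>D. emeasure ?A (S d)) + (\<Sum>k<M. emeasure ?A (T k))"
    using S_sets T_sets finD by (intro add_mono emeasure_subadditive_finite) auto
  also have "\<dots> \<le> (\<Sum>d\<in>D. ennreal (r ^ (2 * N) * (\<Prod>j<M. 1 / (max 1 (cmod (d j)))\<^sup>2)))
      + (\<Sum>k<M. ennreal ((real N * r / real L)\<^sup>2))"
  proof (intro add_mono sum_mono)
    fix d assume "d \<in> D"
    then show "emeasure ?A (S d) \<le> ennreal (r ^ (2 * N) * (\<Prod>j<M. 1 / (max 1 (cmod (d j)))\<^sup>2))"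
      unfolding S_def by (intro cgauss_matrix_box_vector_small_ball MN r) (auto simp: D_def)
  next
    fix k assume "k \<in> {..<M}"
    then show "emeasure ?A (T k) \<le> ennreal ((real N * r / real L)\<^sup>2)"
      unfolding T_def using L
      by (intro cgauss_matrix_long_vector_small_ball MN r countable_gauss_vecs) auto
  qed
  also have "\<dots> = ennreal ((\<Sum>d\<in>D. r ^ (2 * N) * (\<Prod>j<M. 1 / (max 1 (cmod (d j)))\<^sup>2))
      + real M * (real N * r / real L)\<^sup>2)"
    using r by (subst sum_ennreal, simp add: prod_nonneg)
      (simp add: ennreal_plus [symmetric] ennreal_of_nat_eq_real_of_nat ennreal_mult [symmetric]
        sum_nonneg prod_nonneg del: ennreal_plus)
  also have "\<dots> \<le> ennreal ((1 + 2 * harm L) ^ (2 * M) * r ^ (2 * N) + real M * (real N / real L)\<^sup>2 * r ^ 2)"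
  proof (intro ennreal_leI add_mono)
    have "(\<Sum>d\<in>D. \<Prod>j<M. 1 / (max 1 (cmod (d j)))\<^sup>2)
      \<le> (\<Sum>d\<in>PiE {..<M} (\<lambda>_. gauss_box L). \<Prod>j<M. 1 / (max 1 (cmod (d j)))\<^sup>2)"
      by (intro sum_mono2 finite_PiE finite_gauss_box prod_nonneg) (auto simp: D_def)
    also have "\<dots> \<le> (1 + 2 * harm L) ^ (2 * M)" by (rule sum_box_vectors_le)
    finally show "(\<Sum>d\<in>D. r ^ (2 * N) * (\<Prod>j<M. 1 / (max 1 (cmod (d j)))\<^sup>2))
      \<le> (1 + 2 * harm L) ^ (2 * M) * r ^ (2 * N)"
      using r by (simp add: sum_distrib_left [symmetric] mult.commute mult_left_mono)
  qed (simp add: power_mult_distrib power_divide)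
  finally show ?thesis .
qed

text \<open>The sum of the moduli is at most \<open>N\<close> times the largest, whose power is at
  most the sum of all the powers. Each coordinate then contributes a moment of its marginal
  \<open>cgauss s\<close>.\<close>

lemma nn_integral_cgauss_sum_norm_power_le:
  assumes s: "0 < s" and N: "1 \<le> N"
  shows "(\<integral>\<^sup>+w. ennreal ((2 * (\<Sum>i<N. cmod (w i))) ^ (2 * n)) \<partial>PiM {..<N} (\<lambda>_. cgauss s))
    \<le> ennreal ((2 * real N) ^ (2 * n) * real N * (2 * fact n * (2 * s) ^ n))"
proof -
  let ?W = "PiM {..<N} (\<lambda>_. cgauss s)"
  interpret product_prob_space "\<lambda>_ :: nat. cgauss s" "{..<N}"
    by (rule product_prob_space_cgauss) (rule s)
  have pw: "(2 * (\<Sum>i<N. cmod (w i))) ^ (2 * n) \<le> (2 * real N) ^ (2 * n) * (\<Sum>i<N. cmod (w i) ^ (2 * n))"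
    for w :: "nat \<Rightarrow> complex"
  proof -
    have "\<exists>k\<in>{..<N}. \<forall>j\<in>{..<N}. cmod (w j) \<le> cmod (w k)"
      using N by (intro ex_maximizer_finite) (auto simp: lessThan_empty_iff)
    then obtain k where k: "k < N" "\<And>j. j < N \<Longrightarrow> cmod (w j) \<le> cmod (w k)" by auto
    have "(\<Sum>i<N. cmod (w i)) \<le> (\<Sum>i<N. cmod (w k))" using k by (intro sum_mono) auto
    then have "(2 * (\<Sum>i<N. cmod (w i))) ^ (2 * n) \<le> (2 * real N * cmod (w k)) ^ (2 * n)"
      by (intro power_mono) (auto intro!: sum_nonneg)
    also have "\<dots> = (2 * real N) ^ (2 * n) * cmod (w k) ^ (2 * n)"
      by (rule power_mult_distrib)
    also have "\<dots> \<le> (2 * real N) ^ (2 * n) * (\<Sum>i<N. cmod (w i) ^ (2 * n))"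
      using k by (intro mult_left_mono member_le_sum) auto
    finally show ?thesis .
  qed
  have comp: "(\<lambda>w. w i) \<in> measurable ?W (cgauss s)" if "i < N" for i
    using that by (intro measurable_component_singleton) auto
  have meas: "(\<lambda>w. ennreal (cmod (w i) ^ (2 * n))) \<in> borel_measurable ?W" if "i < N" for i
    by (rule measurable_compose[OF comp[OF that]]) measurable
  have mom: "(\<integral>\<^sup>+w. ennreal (cmod (w i) ^ (2 * n)) \<partial>?W) \<le> ennreal (2 * fact n * (2 * s) ^ n)"
    if i: "i < N" for i
  proof -
    have "(\<integral>\<^sup>+w. ennreal (cmod (w i) ^ (2 * n)) \<partial>?W)
      = (\<integral>\<^sup>+z. ennreal (cmod z ^ (2 * n)) \<partial>distr ?W (cgauss s) (\<lambda>w. w i))"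
      using comp[OF i] by (subst nn_integral_distr) auto
    also have "\<dots> = (\<integral>\<^sup>+z. ennreal (cmod z ^ (2 * n)) \<partial>cgauss s)"
      using i by (subst PiM_component) auto
    finally show ?thesis using cgauss_moment_le[OF s, of n] by simp
  qed
  have "(\<integral>\<^sup>+w. ennreal ((2 * (\<Sum>i<N. cmod (w i))) ^ (2 * n)) \<partial>?W)
    \<le> (\<integral>\<^sup>+w. ennreal ((2 * real N) ^ (2 * n)) * (\<Sum>i<N. ennreal (cmod (w i) ^ (2 * n))) \<partial>?W)"
  proof (intro nn_integral_mono)
    fix w :: "nat \<Rightarrow> complex"
    show "ennreal ((2 * (\<Sum>i<N. cmod (w i))) ^ (2 * n))
      \<le> ennreal ((2 * real N) ^ (2 * n)) * (\<Sum>i<N. ennreal (cmod (w i) ^ (2 * n)))"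
      using ennreal_leI[OF pw[of w]] by (simp add: ennreal_mult sum_nonneg)
  qed
  also have "\<dots> = ennreal ((2 * real N) ^ (2 * n)) * (\<Sum>i<N. \<integral>\<^sup>+w. ennreal (cmod (w i) ^ (2 * n)) \<partial>?W)"
    using meas by (subst nn_integral_cmult)
      (auto simp: nn_integral_sum simp del: sum_ennreal intro!: borel_measurable_sum)
  also have "\<dots> \<le> ennreal ((2 * real N) ^ (2 * n)) * (\<Sum>i<N. ennreal (2 * fact n * (2 * s) ^ n))"
    using mom by (intro mult_left_mono sum_mono) auto
  also have "\<dots> = ennreal ((2 * real N) ^ (2 * n) * real N * (2 * fact n * (2 * s) ^ n))"
    using s by (subst sum_ennreal) (auto simp: ennreal_mult [symmetric] mult.assoc)
  finally show ?thesis .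
qed

text \<open>Moments of order \<open>2 * N\<close> and 2 turn the two powers of the noise radius into
  \<open>s ^ N\<close> and \<open>s\<close>. The second has too low an order in \<open>s\<close>
  once \<open>N\<close> exceeds 1; the factor \<open>1 / L^2\<close> hidden in
  \<open>(real N / real L)^2\<close> will compensate for this.\<close>

lemma nn_integral_confusable_le:
  assumes M: "1 \<le> M" and MN: "M \<le> N" and L: "1 \<le> L" and s: "0 < s"
  defines "K \<equiv> \<lambda>n. (2 * real N) ^ (2 * n) * real N * (2 * fact n * 2 ^ n)"
  shows "(\<integral>\<^sup>+w. emeasure (PiM ({..<N} \<times> {..<M}) (\<lambda>_. cgauss 1))
        {H \<in> space (PiM ({..<N} \<times> {..<M}) (\<lambda>_. cgauss 1)). confusable N M H w}
        \<partial>PiM {..<N} (\<lambda>_. cgauss s))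
    \<le> ennreal ((1 + 2 * harm L) ^ (2 * M) * (K N * s ^ N) + real M * (real N / real L)\<^sup>2 * (K 1 * s))"
proof -
  let ?W = "PiM {..<N} (\<lambda>_. cgauss s)"
  let ?r = "\<lambda>w :: nat \<Rightarrow> complex. 2 * (\<Sum>i<N. cmod (w i))"
  define a where "a = (1 + 2 * harm L :: real) ^ (2 * M)"
  define b where "b = real M * (real N / real L)\<^sup>2"
  have ab: "0 \<le> a" "0 \<le> b" by (auto simp: a_def b_def harm_nonneg)
  have N: "1 \<le> N" using M MN by simp
  have [measurable]: "(\<lambda>w. ennreal (?r w ^ n)) \<in> borel_measurable ?W" for n
  proof -
    have [measurable]: "(\<lambda>w. w i) \<in> borel_measurable ?W" if "i < N" for i
      using measurable_component_singleton[of i "{..<N}" "\<lambda>_. cgauss s"] that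
      by (simp cong: measurable_cong_sets)
    show ?thesis by measurable
  qed
  have mom: "(\<integral>\<^sup>+w. ennreal (?r w ^ (2 * n)) \<partial>?W) \<le> ennreal (K n * s ^ n)" for n
    using nn_integral_cgauss_sum_norm_power_le[OF s N, of n]
    by (simp add: K_def power_mult_distrib mult_ac)
  have "(\<integral>\<^sup>+w. emeasure (PiM ({..<N} \<times> {..<M}) (\<lambda>_. cgauss 1))
        {H \<in> space (PiM ({..<N} \<times> {..<M}) (\<lambda>_. cgauss 1)). confusable N M H w} \<partial>?W)
    \<le> (\<integral>\<^sup>+w. ennreal a * ennreal (?r w ^ (2 * N)) + ennreal b * ennreal (?r w ^ (2 * 1)) \<partial>?W)"
  proof (intro nn_integral_mono)
    fix w assume w: "w \<in> space ?W"
    have "0 \<le> ?r w" by (intro mult_nonneg_nonneg sum_nonneg) auto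
    then have "ennreal a * ennreal (?r w ^ (2 * N)) + ennreal b * ennreal (?r w ^ (2 * 1))
      = ennreal (a * ?r w ^ (2 * N) + b * ?r w ^ 2)"
      using ab by (simp only: mult_1_right ennreal_mult [symmetric] ennreal_plus [symmetric]
          zero_le_power mult_nonneg_nonneg)
    with emeasure_confusable_le[OF MN L w]
    show "emeasure (PiM ({..<N} \<times> {..<M}) (\<lambda>_. cgauss 1))
        {H \<in> space (PiM ({..<N} \<times> {..<M}) (\<lambda>_. cgauss 1)). confusable N M H w}
      \<le> ennreal a * ennreal (?r w ^ (2 * N)) + ennreal b * ennreal (?r w ^ (2 * 1))"
      by (simp only: a_def b_def)
  qed
  also have "\<dots> = ennreal a * (\<integral>\<^sup>+w. ennreal (?r w ^ (2 * N)) \<partial>?W)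
      + ennreal b * (\<integral>\<^sup>+w. ennreal (?r w ^ (2 * 1)) \<partial>?W)"
    by (subst nn_integral_add, measurable, subst (1 2) nn_integral_cmult, measurable)
  also have "\<dots> \<le> ennreal a * ennreal (K N * s ^ N) + ennreal b * ennreal (K 1 * s ^ 1)"
    by (intro add_mono mult_left_mono mom) auto
  also have "\<dots> = ennreal (a * (K N * s ^ N) + b * (K 1 * s))"
    using ab s by (simp add: ennreal_mult [symmetric] ennreal_plus [symmetric] K_def del: ennreal_plus)
  finally show ?thesis by (simp add: a_def b_def)
qed

section \<open>The error probability as a function of the SNR\<close>

lemma ennreal_err_prob:
  assumes p: "\<forall>j<M. \<forall>c\<in>set_pmf (p j). gauss_int c" and rho: "0 < rho"
  shows "ennreal (err_prob M N p rho)
    = (\<integral>\<^sup>+w. emeasure (PiM ({..<N} \<times> {..<M}) (\<lambda>_. cgauss 1))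
        {H \<in> space (PiM ({..<N} \<times> {..<M}) (\<lambda>_. cgauss 1)). confusable N M H w}
        \<partial>PiM {..<N} (\<lambda>_. cgauss (1 / rho)))"
proof -
  let ?A = "PiM ({..<N} \<times> {..<M}) (\<lambda>_. cgauss 1)"
  let ?B = "PiM {..<M} (\<lambda>j. measure_pmf (p j))"
  let ?W = "PiM {..<N} (\<lambda>_. cgauss (1 / rho))"
  have s: "0 < 1 / rho" using rho by auto
  interpret A: prob_space ?A by (intro prob_space_PiM prob_space_cgauss) simp
  interpret B: prob_space ?B by (intro prob_space_PiM measure_pmf.prob_space_axioms)
  interpret W: prob_space ?W by (intro prob_space_PiM prob_space_cgauss s)
  interpret BW: pair_prob_space ?B ?W ..
  interpret ABW: pair_prob_space ?A "?B \<Otimes>\<^sub>M ?W" ..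
  interpret S: prob_space "mimo_space M N p (1 / rho)"
    unfolding mimo_space_def by (rule ABW.prob_space_axioms)
  show ?thesis
    unfolding emeasure_nld_error[OF s p, symmetric]
    by (simp add: S.emeasure_eq_measure err_prob_def)
qed

lemma err_prob_lower_bound:
  assumes M: "1 \<le> M" and p: "\<forall>j<M. \<forall>c\<in>set_pmf (p j). gauss_int c" and rho: "1 \<le> rho"
  shows "exp (- 45) ^ N / rho ^ N \<le> err_prob M N p rho"
proof -
  have "ennreal ((exp (- 45) * (1 / rho)) ^ N) \<le> ennreal (err_prob M N p rho)"
    using nn_integral_confusable_ge[OF M, of "1 / rho" N] ennreal_err_prob[OF p, of rho N] rho by simp
  moreover have "0 \<le> err_prob M N p rho" by (simp add: err_prob_def)
  ultimately show ?thesis by (simp add: power_divide)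
qed

lemma err_prob_upper_bound:
  assumes M: "1 \<le> M" and MN: "M \<le> N" and p: "\<forall>j<M. \<forall>c\<in>set_pmf (p j). gauss_int c"
  obtains C where "0 < C"
    "\<And>rho. 1 \<le> rho \<Longrightarrow> err_prob M N p rho \<le> C * (1 + ln rho) ^ (2 * M) / rho ^ N"
proof -
  define K where "K = (\<lambda>n. (2 * real N) ^ (2 * n) * real N * (2 * fact n * 2 ^ n))"
  have N: "1 \<le> N" using M MN by simp
  have K0: "0 < K n" for n using N by (simp add: K_def)
  \<comment> \<open>One summand for each term of the averaged bound; \<open>5 + 2 * real N\<close>
    comes from the estimate of the harmonic number below.\<close>
  define C where "C = (5 + 2 * real N) ^ (2 * M) * K N + real M * (real N)\<^sup>2 * K 1"
  have "0 < C" unfolding C_def using K0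
    by (intro add_pos_nonneg mult_pos_pos mult_nonneg_nonneg) (auto intro: less_imp_le)
  moreover have "err_prob M N p rho \<le> C * (1 + ln rho) ^ (2 * M) / rho ^ N" if rho: "1 \<le> rho" for rho
  proof -
    \<comment> \<open>This size balances the two terms: \<open>ln L\<close> is still of order
      \<open>N * ln rho\<close>, so the box sum costs only powers of the logarithm, while
      \<open>1 / (L^2 * rho)\<close> is already at most \<open>1 / rho ^ N\<close>.\<close>
    define L where "L = nat \<lceil>rho ^ N\<rceil>"
    have R1: "1 \<le> rho ^ N" using rho by (rule one_le_power)
    have Llo: "rho ^ N \<le> real L" unfolding L_def by linarith
    have Lhi: "real L \<le> 2 * rho ^ N" unfolding L_def using R1 by linarith
    have L1: "1 \<le> L" using Llo R1 by linarith
    have ln0: "0 \<le> ln rho" using rho by simp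
    define l where "l = 1 + ln rho"
    have l1: "1 \<le> l" using ln0 by (simp add: l_def)
    have "ln (real L) \<le> ln (2 * rho ^ N)" using Lhi L1 by (subst ln_le_cancel_iff) auto
    also have "\<dots> = ln 2 + real N * ln rho" using rho by (simp add: ln_mult ln_realpow)
    also have "\<dots> \<le> 1 + real N * ln rho" using ln_2_less_1 by simp
    \<comment> \<open>Here \<open>5 = 1 + 2 * (1 + 1)\<close>: inside the bracket one unit comes
      from the bound on \<open>harm L\<close> and one from \<open>ln 2 < 1\<close>.\<close>
    finally have "1 + 2 * harm L \<le> 5 + 2 * real N * ln rho"
      using harm_le_ln_plus_1[OF L1] by simp
    also have "\<dots> \<le> (5 + 2 * real N) * l" using ln0 by (simp add: l_def algebra_simps)
    finally have h: "(1 + 2 * harm L :: real) ^ (2 * M) \<le> ((5 + 2 * real N) * l) ^ (2 * M)"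
      using harm_nonneg[of L, where 'a = real] by (intro power_mono) auto
    have t1: "(1 + 2 * harm L) ^ (2 * M) * (K N * (1 / rho) ^ N)
      \<le> (5 + 2 * real N) ^ (2 * M) * K N * l ^ (2 * M) / rho ^ N"
    proof -
      have "(1 + 2 * harm L) ^ (2 * M) * (K N * (1 / rho) ^ N)
        \<le> ((5 + 2 * real N) * l) ^ (2 * M) * (K N * (1 / rho) ^ N)"
        using h K0[of N] rho by (intro mult_right_mono) auto
      then show ?thesis by (simp add: power_mult_distrib power_divide mult_ac)
    qed
    have t2: "real M * (real N / real L)\<^sup>2 * (K 1 * (1 / rho))
      \<le> real M * (real N)\<^sup>2 * K 1 * l ^ (2 * M) / rho ^ N"
    proof -
      have "rho ^ N * 1 \<le> real L * real L" using Llo L1 R1 by (intro mult_mono) auto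
      then have "rho ^ N * 1 \<le> (real L)\<^sup>2 * rho"
        using rho L1 by (intro mult_mono) (auto simp: power2_eq_square)
      then have "1 / ((real L)\<^sup>2 * rho) \<le> 1 / rho ^ N"
        using rho L1 by (intro divide_left_mono) auto
      also have "\<dots> \<le> l ^ (2 * M) / rho ^ N"
        using l1 rho by (intro divide_right_mono one_le_power) auto
      finally have "(real M * (real N)\<^sup>2 * K 1) * (1 / ((real L)\<^sup>2 * rho))
        \<le> (real M * (real N)\<^sup>2 * K 1) * (l ^ (2 * M) / rho ^ N)"
        using K0[of 1] by (intro mult_left_mono) auto
      then show ?thesis by (simp add: power_divide mult_ac)
    qed
    have "ennreal (err_prob M N p rho) \<le> ennreal ((1 + 2 * harm L) ^ (2 * M) * (K N * (1 / rho) ^ N)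
        + real M * (real N / real L)\<^sup>2 * (K 1 * (1 / rho)))"
      using nn_integral_confusable_le[OF M MN L1, of "1 / rho"] ennreal_err_prob[OF p, of rho N] rho
      unfolding K_def by simp
    also have "\<dots> \<le> ennreal (C * l ^ (2 * M) / rho ^ N)"
      using add_mono[OF t1 t2] by (intro ennreal_leI) (simp add: C_def distrib_right add_divide_distrib)
    finally show ?thesis
      using \<open>0 < C\<close> l1 rho by (simp add: l_def ennreal_le_iff)
  qed
  ultimately show ?thesis by (rule that)
qed

theorem theorem3:
  fixes M N :: nat and C :: "complex set" and p :: "nat \<Rightarrow> complex pmf"
  assumes "1 \<le> M" and "M \<le> N"
    and "finite C" and "\<forall>c\<in>C. gauss_int c"
    and "\<forall>j<M. set_pmf (p j) \<subseteq> C"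
  shows "((\<lambda>rho. - ln (err_prob M N p rho) / ln rho) \<longlongrightarrow> real N) at_top"
proof -
  have p: "\<forall>j<M. \<forall>c\<in>set_pmf (p j). gauss_int c" using assms(4,5) by auto
  obtain B where B: "0 < B"
    "\<And>rho. 1 \<le> rho \<Longrightarrow> err_prob M N p rho \<le> B * (1 + ln rho) ^ (2 * M) / rho ^ N"
    using err_prob_upper_bound[OF assms(1,2) p] by blast
  \<comment> \<open>Logarithms can be compared only once the error probability is known to be
    strictly positive.\<close>
  have c0: "0 < exp (- 45) ^ N / rho ^ N" if "1 < rho" for rho :: real
    using that by (intro divide_pos_pos zero_less_power) simp_all
  have lim1: "((\<lambda>rho :: real. 1 / ln rho) \<longlongrightarrow> 0) at_top" by real_asymp
  have lim2: "((\<lambda>rho :: real. ln (1 + ln rho) / ln rho) \<longlongrightarrow> 0) at_top" by real_asymp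
  \<comment> \<open>An upper bound on the probability gives a lower bound on the exponent. This is
    the exponent of \<open>B * (1 + ln rho) ^ (2 * M) / rho ^ N\<close>, whose constant and
    logarithmic factor vanish after division by \<open>ln rho\<close>.\<close>
  have low: "((\<lambda>rho. real N - ln B * (1 / ln rho) - real (2 * M) * (ln (1 + ln rho) / ln rho))
      \<longlongrightarrow> real N) at_top"
    using tendsto_diff[OF tendsto_diff[OF tendsto_const[of "real N"] tendsto_mult_left[OF lim1, of "ln B"]]
        tendsto_mult_left[OF lim2, of "real (2 * M)"]] by simp
  \<comment> \<open>The exponent of the lower bound \<open>exp (- 45) ^ N / rho ^ N\<close>.\<close>
  have high: "((\<lambda>rho. real N + 45 * real N * (1 / ln rho)) \<longlongrightarrow> real N) at_top"
    using tendsto_add[OF tendsto_const[of "real N"] tendsto_mult_left[OF lim1, of "45 * real N"]] by simp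
  show ?thesis
  proof (rule tendsto_sandwich[OF _ _ low high])
    show "\<forall>\<^sub>F rho in at_top. real N - ln B * (1 / ln rho) - real (2 * M) * (ln (1 + ln rho) / ln rho)
      \<le> - ln (err_prob M N p rho) / ln rho"
      using eventually_gt_at_top[of 1]
    proof eventually_elim
      case (elim rho)
      have l0: "0 < ln rho" using elim by simp
      have l1: "1 + ln rho \<noteq> 0" using l0 by linarith
      have pos: "0 < err_prob M N p rho"
        using less_le_trans[OF c0 err_prob_lower_bound[OF assms(1) p]] elim by simp
      have "ln (err_prob M N p rho) \<le> ln (B * (1 + ln rho) ^ (2 * M) / rho ^ N)"
        using B(2)[of rho] pos elim by (intro ln_mono) auto
      also have "\<dots> = ln B + real (2 * M) * ln (1 + ln rho) - real N * ln rho"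
        using B(1) l1 elim by (simp add: ln_div ln_mult ln_realpow)
      finally have "(real N * ln rho - ln B - real (2 * M) * ln (1 + ln rho)) / ln rho
        \<le> - ln (err_prob M N p rho) / ln rho"
        using l0 by (intro divide_right_mono) auto
      then show ?case using l0 by (simp add: diff_divide_distrib)
    qed
    show "\<forall>\<^sub>F rho in at_top. - ln (err_prob M N p rho) / ln rho \<le> real N + 45 * real N * (1 / ln rho)"
      using eventually_gt_at_top[of 1]
    proof eventually_elim
      case (elim rho)
      have l0: "0 < ln rho" using elim by simp
      have "ln (exp (- 45) ^ N / rho ^ N) \<le> ln (err_prob M N p rho)"
        using err_prob_lower_bound[OF assms(1) p, of rho N] c0[of rho] elim by (simp add: ln_mono)
      moreover have "ln (exp (- 45) ^ N / rho ^ N) = - 45 * real N - real N * ln rho"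
        using elim by (subst ln_div) (simp_all add: ln_realpow)
      ultimately have "- ln (err_prob M N p rho) / ln rho \<le> (real N * ln rho + 45 * real N) / ln rho"
        using l0 by (intro divide_right_mono) auto
      then show ?case using l0 by (simp add: add_divide_distrib)
    qed
  qed
qed

end
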